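(* Let $G$ be a groupoid over $M$ in a tangent category, let $\pi:A\to M$ with anchor $\varrho$ be its associated anchored bundle, and define $\alpha:A\times_{\varrho,T(\pi)}T(A)\to T(A)$ by $$\alpha(v,w)=cw\circ 0v\circ(c0pw)^{-1}.$$ Then $\alpha$ is a linear bundle morphism from $(A\times_{\varrho,T(\pi)}T(A),p\pi_1)$ to $(T(A),T(\pi))$ over $\varrho$.
   Context: Conventions: composition of arrows is juxtaposition in applicative order ($gf$: first $f$, then $g$); subscripts of natural transformations are omitted; equations may be read on generalised elements. An additive bundle over $M$ is a commutative monoid in the slice category over $M$: an arrow $q:E\to M$, zero $\xi:M\to E$, addition $+_q$. A morphism is a commuting square preserving zero and addition. A tangent category is a category with an endofunctor $T$ and natural transformations $p:T\Rightarrow\mathrm{id}$, $0:\mathrm{id}\Rightarrow T$, $+:T\times_{p,p}T\Rightarrow T$, $l:T\Rightarrow T^2$, $c:T^2\Rightarrow T^2$ such that: pullback powers of $p$ exist and are preserved by $T$; each $(p_M,0_M,+_M)$ is an additive bundle; $(l,0):p\Rightarrow T(p)$ and $(c,\mathrm{id}):T(p)\Rightarrow p$ are additive bundle morphisms; $cc=\mathrm{id}$, $T(c)cT(c)=cT(c)c$, $cl=l$, $T(l)l=ll$, $cT(c)l=T(l)c$; and $\mu(a,b)=T(+)(0b,la)$, $T(M)\times_MT(M)\to T^2(M)$, is an equaliser of $T(p)$ and $0pp$. Standing assumptions: negatives (additive bundles are commutative groups in the slice) and all limits used exist and are preserved by $T$. The groupoid $G$ has identity $e:M\to G$, source and target $s,t:G\to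 M$, inverse $(-)^{-1}$; $g\circ h$ is defined when $s(g)=t(h)$. In $T^2(G)$, $\circ$ and $(-)^{-1}$ denote the operations obtained by applying $T^2$, so $g\circ h$ is defined when $T^2(s)g=T^2(t)h$. Associated anchored bundle: $A$ is the pullback of $(p,T(s)):T(G)\to G\times T(M)$ along $(e,0):M\to G\times T(M)$, with projection $\pi:A\to M$ and monomorphism $\iota:A\rightarrowtail T(G)$. Thus elements of $A$ are $v\in T(G)$ with $pv=em$, $T(s)v=0m$, $m=\pi v$; elements of $T(A)$ are regarded as elements $w\in T^2(G)$ with $T(p)w=T(e)T(\pi)w$ and $T^2(s)w=T(0)T(\pi)w$. Zero section, addition and lift are inherited from $(T(G),p)$: $\xi=0e$, $\lambda v=lv$. The anchor is $\varrho=T(t)\iota:A\to T(M)$. The prolongation $P=A\times_{\varrho,T(\pi)}T(A)$ is the pullback of $\varrho$ and $T(\pi):T(A)\to T(M)$, projections $\pi_0,\pi_1$. The composite defining $\alpha(v,w)$ is defined in $T^2(G)$ and lies in $T(A)$. A bundle morphism from $(E,q)$ to $(E',q')$ with lifts $\lambda,\lambda'$ over $\phi_0$ is $\phi_1:E\to E'$ with $q'\phi_1=\phi_0q$; it is linear if $T(\phi_1)\lambda=\lambda'\phi_1$. Here $(P,p\pi_1)$ has lift $\lambda\times l$ and $(T(A),T(\pi))$ has lift $cT(\lambda)$; so the claim says $T(\pi)\alpha=\varrho p\pi_1$ and $T(\alpha)(\lambda v,lw)=cT(\lambda)\alpha(v,w)$. *)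

theory Defs
  imports Main
begin

record ('o, 'a) category_data =
  Ob :: "'o set"
  Ar :: "'a set"
  Dom :: "'a \<Rightarrow> 'o"
  Cod :: "'a \<Rightarrow> 'o"
  Id :: "'o \<Rightarrow> 'a"
  Cmp :: "'a \<Rightarrow> 'a \<Rightarrow> 'a" (infixr "\<cdot>\<index>" 70)

definition hom :: "('o, 'a, 'm) category_data_scheme \<Rightarrow> 'o \<Rightarrow> 'o \<Rightarrow> 'a set" where
  "hom C X Y = {f \<in> Ar C. Dom C f = X \<and> Cod C f = Y}"

locale category =
  fixes C :: "('o, 'a, 'm) category_data_scheme" (structure)
  assumes Dom_in_Ob: "f \<in> Ar C \<Longrightarrow> Dom C f \<in> Ob C"
    and Cod_in_Ob: "f \<in> Ar C \<Longrightarrow> Cod C f \<in> Ob C"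
    and Id_hom: "X \<in> Ob C \<Longrightarrow> Id C X \<in> hom C X X"
    and Cmp_hom: "f \<in> hom C X Y \<Longrightarrow> g \<in> hom C Y Z \<Longrightarrow> g \<cdot> f \<in> hom C X Z"
    and Cmp_Id: "f \<in> hom C X Y \<Longrightarrow> f \<cdot> Id C X = f"
    and Id_Cmp: "f \<in> hom C X Y \<Longrightarrow> Id C Y \<cdot> f = f"
    and Cmp_assoc: "f \<in> hom C W X \<Longrightarrow> g \<in> hom C X Y \<Longrightarrow> h \<in> hom C Y Z \<Longrightarrow>
      (h \<cdot> g) \<cdot> f = h \<cdot> (g \<cdot> f)"

definition is_product ::
    "('o, 'a, 'm) category_data_scheme \<Rightarrow> 'o \<Rightarrow> 'o \<Rightarrow> 'o \<Rightarrow> 'a \<Rightarrow> 'a \<Rightarrow> bool" where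
  "is_product C X Y Q a b \<longleftrightarrow>
     a \<in> hom C Q X \<and> b \<in> hom C Q Y \<and>
     (\<forall>W x y. x \<in> hom C W X \<and> y \<in> hom C W Y \<longrightarrow>
        (\<exists>!u. u \<in> hom C W Q \<and> a \<cdot>\<^bsub>C\<^esub> u = x \<and> b \<cdot>\<^bsub>C\<^esub> u = y))"

definition is_pullback ::
    "('o, 'a, 'm) category_data_scheme \<Rightarrow> 'a \<Rightarrow> 'a \<Rightarrow> 'o \<Rightarrow> 'a \<Rightarrow> 'a \<Rightarrow> bool" where
  "is_pullback C f g P a b \<longleftrightarrow>
     f \<in> Ar C \<and> g \<in> Ar C \<and> Cod C f = Cod C g \<and>
     a \<in> hom C P (Dom C f) \<and> b \<in> hom C P (Dom C g) \<and> f \<cdot>\<^bsub>C\<^esub> a = g \<cdot>\<^bsub>C\<^esub> b \<and>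
     (\<forall>W x y. x \<in> hom C W (Dom C f) \<and> y \<in> hom C W (Dom C g) \<and> f \<cdot>\<^bsub>C\<^esub> x = g \<cdot>\<^bsub>C\<^esub> y \<longrightarrow>
        (\<exists>!u. u \<in> hom C W P \<and> a \<cdot>\<^bsub>C\<^esub> u = x \<and> b \<cdot>\<^bsub>C\<^esub> u = y))"

definition is_equaliser ::
    "('o, 'a, 'm) category_data_scheme \<Rightarrow> 'a \<Rightarrow> 'a \<Rightarrow> 'o \<Rightarrow> 'a \<Rightarrow> bool" where
  "is_equaliser C f g E m \<longleftrightarrow>
     f \<in> Ar C \<and> g \<in> hom C (Dom C f) (Cod C f) \<and>
     m \<in> hom C E (Dom C f) \<and> f \<cdot>\<^bsub>C\<^esub> m = g \<cdot>\<^bsub>C\<^esub> m \<and>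
     (\<forall>W h. h \<in> hom C W (Dom C f) \<and> f \<cdot>\<^bsub>C\<^esub> h = g \<cdot>\<^bsub>C\<^esub> h \<longrightarrow>
        (\<exists>!u. u \<in> hom C W E \<and> m \<cdot>\<^bsub>C\<^esub> u = h))"

text \<open>The \<open>n\<close>-th pullback power of \<open>q\<close>, with projections \<open>pr i\<close> for \<open>i < n\<close> and structure map
  \<open>r\<close> to the codomain of \<open>q\<close>; for \<open>n = 0\<close> this is an isomorphic copy of the codomain.\<close>

definition is_pullback_power ::
    "('o, 'a, 'm) category_data_scheme \<Rightarrow> nat \<Rightarrow> 'a \<Rightarrow> 'o \<Rightarrow> 'a \<Rightarrow> (nat \<Rightarrow> 'a) \<Rightarrow> bool" where
  "is_pullback_power C n q W r pr \<longleftrightarrow>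
     q \<in> Ar C \<and> r \<in> hom C W (Cod C q) \<and>
     (\<forall>i<n. pr i \<in> hom C W (Dom C q) \<and> q \<cdot>\<^bsub>C\<^esub> pr i = r) \<and>
     (\<forall>V b x. b \<in> hom C V (Cod C q) \<and> (\<forall>i<n. x i \<in> hom C V (Dom C q) \<and> q \<cdot>\<^bsub>C\<^esub> x i = b) \<longrightarrow>
        (\<exists>!u. u \<in> hom C V W \<and> r \<cdot>\<^bsub>C\<^esub> u = b \<and> (\<forall>i<n. pr i \<cdot>\<^bsub>C\<^esub> u = x i)))"

text \<open>The arrow \<open>(x, y)\<close> into a product or pullback \<open>P\<close> with projections \<open>a\<close>, \<open>b\<close>.\<close>

definition pair ::
    "('o, 'a, 'm) category_data_scheme \<Rightarrow> 'o \<Rightarrow> 'a \<Rightarrow> 'a \<Rightarrow> 'a \<Rightarrow> 'a \<Rightarrow> 'a" where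
  "pair C P a b x y = (THE u. u \<in> hom C (Dom C x) P \<and> a \<cdot>\<^bsub>C\<^esub> u = x \<and> b \<cdot>\<^bsub>C\<^esub> u = y)"

text \<open>The factorisation of \<open>f\<close> through the monomorphism \<open>m\<close>.\<close>

definition factor :: "('o, 'a, 'm) category_data_scheme \<Rightarrow> 'a \<Rightarrow> 'a \<Rightarrow> 'a" where
  "factor C m f = (THE u. u \<in> hom C (Dom C f) (Dom C m) \<and> m \<cdot>\<^bsub>C\<^esub> u = f)"

text \<open>\<open>sq\<close> is the fibre product of \<open>tot\<close> with itself over \<open>bas\<close> and \<open>fs\<close>, \<open>sn\<close> are its
  projections.\<close>

record ('o, 'a) bundle_data =
  bas :: 'o
  tot :: 'o
  prj :: 'a
  sq :: 'o
  fs :: 'a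
  sn :: 'a
  zer :: 'a
  pls :: 'a

definition bpair :: "('o, 'a, 'm) category_data_scheme \<Rightarrow> ('o, 'a) bundle_data \<Rightarrow> 'a \<Rightarrow> 'a \<Rightarrow> 'a" where
  "bpair C B x y = pair C (sq B) (fs B) (sn B) x y"

definition badd :: "('o, 'a, 'm) category_data_scheme \<Rightarrow> ('o, 'a) bundle_data \<Rightarrow> 'a \<Rightarrow> 'a \<Rightarrow> 'a" where
  "badd C B x y = pls B \<cdot>\<^bsub>C\<^esub> bpair C B x y"

text \<open>A commutative monoid in the slice category, with the monoid laws read on generalised elements.\<close>

definition additive_bundle ::
    "('o, 'a, 'm) category_data_scheme \<Rightarrow> ('o, 'a) bundle_data \<Rightarrow> bool" where
  "additive_bundle C B \<longleftrightarrow>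
     prj B \<in> hom C (tot B) (bas B) \<and>
     is_pullback C (prj B) (prj B) (sq B) (fs B) (sn B) \<and>
     zer B \<in> hom C (bas B) (tot B) \<and> prj B \<cdot>\<^bsub>C\<^esub> zer B = Id C (bas B) \<and>
     pls B \<in> hom C (sq B) (tot B) \<and> prj B \<cdot>\<^bsub>C\<^esub> pls B = prj B \<cdot>\<^bsub>C\<^esub> fs B \<and>
     (\<forall>X. \<forall>x\<in>hom C X (tot B).
        badd C B x (zer B \<cdot>\<^bsub>C\<^esub> prj B \<cdot>\<^bsub>C\<^esub> x) = x \<and>
        (\<forall>y\<in>hom C X (tot B). prj B \<cdot>\<^bsub>C\<^esub> x = prj B \<cdot>\<^bsub>C\<^esub> y \<longrightarrow>
           badd C B x y = badd C B y x \<and>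
           (\<forall>z\<in>hom C X (tot B). prj B \<cdot>\<^bsub>C\<^esub> y = prj B \<cdot>\<^bsub>C\<^esub> z \<longrightarrow>
              badd C B (badd C B x y) z = badd C B x (badd C B y z))))"

definition has_negatives ::
    "('o, 'a, 'm) category_data_scheme \<Rightarrow> ('o, 'a) bundle_data \<Rightarrow> bool" where
  "has_negatives C B \<longleftrightarrow>
     (\<exists>n\<in>hom C (tot B) (tot B). prj B \<cdot>\<^bsub>C\<^esub> n = prj B \<and>
        badd C B (Id C (tot B)) n = zer B \<cdot>\<^bsub>C\<^esub> prj B)"

definition additive_bundle_morphism ::
    "('o, 'a, 'm) category_data_scheme \<Rightarrow> ('o, 'a) bundle_data \<Rightarrow> ('o, 'a) bundle_data \<Rightarrow>
       'a \<Rightarrow> 'a \<Rightarrow> bool" where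
  "additive_bundle_morphism C B B' f1 f0 \<longleftrightarrow>
     f1 \<in> hom C (tot B) (tot B') \<and> f0 \<in> hom C (bas B) (bas B') \<and>
     prj B' \<cdot>\<^bsub>C\<^esub> f1 = f0 \<cdot>\<^bsub>C\<^esub> prj B \<and>
     f1 \<cdot>\<^bsub>C\<^esub> zer B = zer B' \<cdot>\<^bsub>C\<^esub> f0 \<and>
     f1 \<cdot>\<^bsub>C\<^esub> pls B = badd C B' (f1 \<cdot>\<^bsub>C\<^esub> fs B) (f1 \<cdot>\<^bsub>C\<^esub> sn B)"

text \<open>\<open>TO\<close> and \<open>TA\<close> are the object and arrow parts of \<open>T\<close>; \<open>T2 M\<close>, with projections \<open>t0 M\<close> and
  \<open>t1 M\<close>, is the chosen pullback of \<open>p\<close> along itself.\<close>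

record ('o, 'a) tangent_data = "('o, 'a) category_data" +
  TO :: "'o \<Rightarrow> 'o" ("\<T>\<^sub>o\<index>")
  TA :: "'a \<Rightarrow> 'a" ("\<T>\<index>")
  tproj :: "'o \<Rightarrow> 'a" ("\<pp>\<index>")
  tzero :: "'o \<Rightarrow> 'a" ("\<zero>\<index>")
  T2 :: "'o \<Rightarrow> 'o"
  t0 :: "'o \<Rightarrow> 'a"
  t1 :: "'o \<Rightarrow> 'a"
  tadd :: "'o \<Rightarrow> 'a"
  tlift :: "'o \<Rightarrow> 'a" ("\<ll>\<index>")
  tflip :: "'o \<Rightarrow> 'a" ("\<cc>\<index>")

text \<open>Preservation by \<open>T\<close> is understood for all iterates of \<open>T\<close>; the case \<open>n = 0\<close> says that the cone
  itself is a limit.\<close>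

definition T_product ::
    "('o, 'a, 'm) tangent_data_scheme \<Rightarrow> 'o \<Rightarrow> 'o \<Rightarrow> 'o \<Rightarrow> 'a \<Rightarrow> 'a \<Rightarrow> bool" where
  "T_product C X Y Q a b \<longleftrightarrow>
     (\<forall>n. is_product C ((TO C ^^ n) X) ((TO C ^^ n) Y) ((TO C ^^ n) Q) ((TA C ^^ n) a) ((TA C ^^ n) b))"

definition T_pullback ::
    "('o, 'a, 'm) tangent_data_scheme \<Rightarrow> 'a \<Rightarrow> 'a \<Rightarrow> 'o \<Rightarrow> 'a \<Rightarrow> 'a \<Rightarrow> bool" where
  "T_pullback C f g P a b \<longleftrightarrow>
     (\<forall>n. is_pullback C ((TA C ^^ n) f) ((TA C ^^ n) g) ((TO C ^^ n) P) ((TA C ^^ n) a) ((TA C ^^ n) b))"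

definition T_equaliser ::
    "('o, 'a, 'm) tangent_data_scheme \<Rightarrow> 'a \<Rightarrow> 'a \<Rightarrow> 'o \<Rightarrow> 'a \<Rightarrow> bool" where
  "T_equaliser C f g E m \<longleftrightarrow>
     (\<forall>n. is_equaliser C ((TA C ^^ n) f) ((TA C ^^ n) g) ((TO C ^^ n) E) ((TA C ^^ n) m))"

definition T_pullback_power ::
    "('o, 'a, 'm) tangent_data_scheme \<Rightarrow> nat \<Rightarrow> 'a \<Rightarrow> 'o \<Rightarrow> 'a \<Rightarrow> (nat \<Rightarrow> 'a) \<Rightarrow> bool" where
  "T_pullback_power C k q W r pr \<longleftrightarrow>
     (\<forall>n. is_pullback_power C k ((TA C ^^ n) q) ((TO C ^^ n) W) ((TA C ^^ n) r) (\<lambda>i. (TA C ^^ n) (pr i)))"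

text \<open>\<open>F0\<close>, \<open>G0\<close> are the object parts and \<open>F1\<close>, \<open>G1\<close> the arrow parts of two endofunctors.\<close>

definition natural ::
    "('o, 'a, 'm) category_data_scheme \<Rightarrow> ('o \<Rightarrow> 'o) \<Rightarrow> ('a \<Rightarrow> 'a) \<Rightarrow> ('o \<Rightarrow> 'o) \<Rightarrow> ('a \<Rightarrow> 'a) \<Rightarrow>
       ('o \<Rightarrow> 'a) \<Rightarrow> bool" where
  "natural C F0 F1 G0 G1 \<eta> \<longleftrightarrow>
     (\<forall>X\<in>Ob C. \<eta> X \<in> hom C (F0 X) (G0 X)) \<and>
     (\<forall>X Y. \<forall>f\<in>hom C X Y. G1 f \<cdot>\<^bsub>C\<^esub> \<eta> X = \<eta> Y \<cdot>\<^bsub>C\<^esub> F1 f)"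

definition T2_map :: "('o, 'a, 'm) tangent_data_scheme \<Rightarrow> 'a \<Rightarrow> 'a" where
  "T2_map C f = pair C (T2 C (Cod C f)) (t0 C (Cod C f)) (t1 C (Cod C f))
     (TA C f \<cdot>\<^bsub>C\<^esub> t0 C (Dom C f)) (TA C f \<cdot>\<^bsub>C\<^esub> t1 C (Dom C f))"

definition tangent_bundle :: "('o, 'a, 'm) tangent_data_scheme \<Rightarrow> 'o \<Rightarrow> ('o, 'a) bundle_data" where
  "tangent_bundle C M = \<lparr>bas = M, tot = TO C M, prj = tproj C M,
     sq = T2 C M, fs = t0 C M, sn = t1 C M, zer = tzero C M, pls = tadd C M\<rparr>"

definition T_bundle ::
    "('o, 'a, 'm) tangent_data_scheme \<Rightarrow> ('o, 'a) bundle_data \<Rightarrow> ('o, 'a) bundle_data" where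
  "T_bundle C B = \<lparr>bas = TO C (bas B), tot = TO C (tot B), prj = TA C (prj B),
     sq = TO C (sq B), fs = TA C (fs B), sn = TA C (sn B), zer = TA C (zer B), pls = TA C (pls B)\<rparr>"

text \<open>\<open>\<mu>(a, b) = T(+)(0b, la)\<close>\<close>

definition tmu :: "('o, 'a, 'm) tangent_data_scheme \<Rightarrow> 'o \<Rightarrow> 'a" where
  "tmu C M = badd C (T_bundle C (tangent_bundle C M))
     (tzero C (TO C M) \<cdot>\<^bsub>C\<^esub> t1 C M) (tlift C M \<cdot>\<^bsub>C\<^esub> t0 C M)"

locale tangent_category = category C
  for C :: "('o, 'a, 'm) tangent_data_scheme" (structure) +
  assumes T_Ob: "X \<in> Ob C \<Longrightarrow> \<T>\<^sub>o X \<in> Ob C"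
    and T_hom: "f \<in> hom C X Y \<Longrightarrow> \<T> f \<in> hom C (\<T>\<^sub>o X) (\<T>\<^sub>o Y)"
    and T_Id: "X \<in> Ob C \<Longrightarrow> \<T> (Id C X) = Id C (\<T>\<^sub>o X)"
    and T_Cmp: "f \<in> hom C X Y \<Longrightarrow> g \<in> hom C Y Z \<Longrightarrow> \<T> (g \<cdot> f) = \<T> g \<cdot> \<T> f"
    and pullback_T2: "M \<in> Ob C \<Longrightarrow> T_pullback C (\<pp> M) (\<pp> M) (T2 C M) (t0 C M) (t1 C M)"
    and pullback_powers: "M \<in> Ob C \<Longrightarrow> \<exists>W r pr. T_pullback_power C k (\<pp> M) W r pr"
    and natural_p: "natural C \<T>\<^sub>o \<T> (\<lambda>X. X) (\<lambda>f. f) \<pp>"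
    and natural_0: "natural C (\<lambda>X. X) (\<lambda>f. f) \<T>\<^sub>o \<T> \<zero>"
    and natural_add: "natural C (T2 C) (T2_map C) \<T>\<^sub>o \<T> (tadd C)"
    and natural_l: "natural C \<T>\<^sub>o \<T> (\<lambda>X. \<T>\<^sub>o (\<T>\<^sub>o X)) (\<lambda>f. \<T> (\<T> f)) \<ll>"
    and natural_c: "natural C (\<lambda>X. \<T>\<^sub>o (\<T>\<^sub>o X)) (\<lambda>f. \<T> (\<T> f)) (\<lambda>X. \<T>\<^sub>o (\<T>\<^sub>o X)) (\<lambda>f. \<T> (\<T> f)) \<cc>"
    and additive_p: "M \<in> Ob C \<Longrightarrow> additive_bundle C (tangent_bundle C M)"
    and negatives_p: "M \<in> Ob C \<Longrightarrow> has_negatives C (tangent_bundle C M)"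
    and additive_l: "M \<in> Ob C \<Longrightarrow>
      additive_bundle_morphism C (tangent_bundle C M) (T_bundle C (tangent_bundle C M)) (\<ll> M) (\<zero> M)"
    and additive_c: "M \<in> Ob C \<Longrightarrow>
      additive_bundle_morphism C (T_bundle C (tangent_bundle C M)) (tangent_bundle C (\<T>\<^sub>o M))
        (\<cc> M) (Id C (\<T>\<^sub>o M))"
    and c_c: "M \<in> Ob C \<Longrightarrow> \<cc> M \<cdot> \<cc> M = Id C (\<T>\<^sub>o (\<T>\<^sub>o M))"
    and Tc_c_Tc: "M \<in> Ob C \<Longrightarrow>
      \<T> (\<cc> M) \<cdot> \<cc> (\<T>\<^sub>o M) \<cdot> \<T> (\<cc> M) = \<cc> (\<T>\<^sub>o M) \<cdot> \<T> (\<cc> M) \<cdot> \<cc> (\<T>\<^sub>o M)"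
    and c_l: "M \<in> Ob C \<Longrightarrow> \<cc> M \<cdot> \<ll> M = \<ll> M"
    and Tl_l: "M \<in> Ob C \<Longrightarrow> \<T> (\<ll> M) \<cdot> \<ll> M = \<ll> (\<T>\<^sub>o M) \<cdot> \<ll> M"
    and c_Tc_l: "M \<in> Ob C \<Longrightarrow> \<cc> (\<T>\<^sub>o M) \<cdot> \<T> (\<cc> M) \<cdot> \<ll> (\<T>\<^sub>o M) = \<T> (\<ll> M) \<cdot> \<cc> M"
    and vertical_lift: "M \<in> Ob C \<Longrightarrow>
      T_equaliser C (\<T> (\<pp> M)) (\<zero> M \<cdot> \<pp> M \<cdot> \<pp> (\<T>\<^sub>o M)) (T2 C M) (tmu C M)"

text \<open>\<open>gpairs\<close>, with projections \<open>gfst\<close> and \<open>gsnd\<close>, is the object of pairs \<open>(g, h)\<close> with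
  \<open>s(g) = t(h)\<close>, and \<open>gmult : gpairs \<rightarrow> garr\<close> is \<open>(g, h) \<mapsto> g \<circ> h\<close>.\<close>

record ('o, 'a) groupoid_data =
  gobj :: 'o
  garr :: 'o
  gsrc :: 'a
  gtgt :: 'a
  gunit :: 'a
  ginverse :: 'a
  gpairs :: 'o
  gfst :: 'a
  gsnd :: 'a
  gmult :: 'a

text \<open>The operations on generalised elements of \<open>T\<^sup>n(G)\<close> induced by those of \<open>G\<close>.\<close>

definition gcomp ::
    "('o, 'a, 'm) tangent_data_scheme \<Rightarrow> ('o, 'a) groupoid_data \<Rightarrow> nat \<Rightarrow> 'a \<Rightarrow> 'a \<Rightarrow> 'a" where
  "gcomp C G n g h = (TA C ^^ n) (gmult G) \<cdot>\<^bsub>C\<^esub>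
     pair C ((TO C ^^ n) (gpairs G)) ((TA C ^^ n) (gfst G)) ((TA C ^^ n) (gsnd G)) g h"

definition ginv ::
    "('o, 'a, 'm) tangent_data_scheme \<Rightarrow> ('o, 'a) groupoid_data \<Rightarrow> nat \<Rightarrow> 'a \<Rightarrow> 'a" where
  "ginv C G n g = (TA C ^^ n) (ginverse G) \<cdot>\<^bsub>C\<^esub> g"

locale groupoid = tangent_category C
  for C :: "('o, 'a, 'm) tangent_data_scheme" (structure)
    and G :: "('o, 'a) groupoid_data" +
  assumes gobj: "gobj G \<in> Ob C"
    and garr: "garr G \<in> Ob C"
    and gsrc: "gsrc G \<in> hom C (garr G) (gobj G)"
    and gtgt: "gtgt G \<in> hom C (garr G) (gobj G)"
    and gunit: "gunit G \<in> hom C (gobj G) (garr G)"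
    and ginverse: "ginverse G \<in> hom C (garr G) (garr G)"
    and gmult: "gmult G \<in> hom C (gpairs G) (garr G)"
    and gpairs: "T_pullback C (gsrc G) (gtgt G) (gpairs G) (gfst G) (gsnd G)"
    and gtriples: "\<exists>G3 q0 q1. T_pullback C (gsnd G) (gfst G) G3 q0 q1"
    and src_unit: "gsrc G \<cdot> gunit G = Id C (gobj G)"
    and tgt_unit: "gtgt G \<cdot> gunit G = Id C (gobj G)"
    and src_mult: "gsrc G \<cdot> gmult G = gsrc G \<cdot> gsnd G"
    and tgt_mult: "gtgt G \<cdot> gmult G = gtgt G \<cdot> gfst G"
    and src_inv: "gsrc G \<cdot> ginverse G = gtgt G"
    and tgt_inv: "gtgt G \<cdot> ginverse G = gsrc G"
    and mult_assoc: "g \<in> hom C X (garr G) \<Longrightarrow> h \<in> hom C X (garr G) \<Longrightarrow> k \<in> hom C X (garr G) \<Longrightarrow>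
      gsrc G \<cdot> g = gtgt G \<cdot> h \<Longrightarrow> gsrc G \<cdot> h = gtgt G \<cdot> k \<Longrightarrow>
      gcomp C G 0 (gcomp C G 0 g h) k = gcomp C G 0 g (gcomp C G 0 h k)"
    and mult_unit: "g \<in> hom C X (garr G) \<Longrightarrow> gcomp C G 0 g (gunit G \<cdot> gsrc G \<cdot> g) = g"
    and unit_mult: "g \<in> hom C X (garr G) \<Longrightarrow> gcomp C G 0 (gunit G \<cdot> gtgt G \<cdot> g) g = g"
    and mult_inv: "g \<in> hom C X (garr G) \<Longrightarrow> gcomp C G 0 g (ginv C G 0 g) = gunit G \<cdot> gtgt G \<cdot> g"
    and inv_mult: "g \<in> hom C X (garr G) \<Longrightarrow> gcomp C G 0 (ginv C G 0 g) g = gunit G \<cdot> gsrc G \<cdot> g"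

text \<open>\<open>A\<close> is the pullback of \<open>(p, T(s)) : T(G) \<rightarrow> G \<times> T(M)\<close> along \<open>(e, 0) : M \<rightarrow> G \<times> T(M)\<close>, where \<open>Q\<close>
  is the product.\<close>

definition associated_bundle ::
    "('o, 'a, 'm) tangent_data_scheme \<Rightarrow> ('o, 'a) groupoid_data \<Rightarrow> 'o \<Rightarrow> 'a \<Rightarrow> 'a \<Rightarrow> bool" where
  "associated_bundle C G A \<pi> \<iota> \<longleftrightarrow>
     (\<exists>Q q0 q1. T_product C (garr G) (TO C (gobj G)) Q q0 q1 \<and>
        T_pullback C (pair C Q q0 q1 (tproj C (garr G)) (TA C (gsrc G)))
          (pair C Q q0 q1 (gunit G) (tzero C (gobj G))) A \<iota> \<pi>)"

definition anchor ::
    "('o, 'a, 'm) tangent_data_scheme \<Rightarrow> ('o, 'a) groupoid_data \<Rightarrow> 'a \<Rightarrow> 'a" where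
  "anchor C G \<iota> = TA C (gtgt G) \<cdot>\<^bsub>C\<^esub> \<iota>"

text \<open>The lift \<open>\<lambda> : A \<rightarrow> T(A)\<close>, determined by \<open>T(\<iota>)\<lambda> = l\<iota>\<close>.\<close>

definition assoc_lift ::
    "('o, 'a, 'm) tangent_data_scheme \<Rightarrow> ('o, 'a) groupoid_data \<Rightarrow> 'a \<Rightarrow> 'a" where
  "assoc_lift C G \<iota> = factor C (TA C \<iota>) (tlift C (garr G) \<cdot>\<^bsub>C\<^esub> \<iota>)"

definition prolongation ::
    "('o, 'a, 'm) tangent_data_scheme \<Rightarrow> ('o, 'a) groupoid_data \<Rightarrow> 'a \<Rightarrow> 'a \<Rightarrow>
       'o \<Rightarrow> 'a \<Rightarrow> 'a \<Rightarrow> bool" where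
  "prolongation C G \<pi> \<iota> P \<pi>0 \<pi>1 \<longleftrightarrow> T_pullback C (anchor C G \<iota>) (TA C \<pi>) P \<pi>0 \<pi>1"

definition prolong_lift ::
    "('o, 'a, 'm) tangent_data_scheme \<Rightarrow> ('o, 'a) groupoid_data \<Rightarrow> 'o \<Rightarrow> 'a \<Rightarrow>
       'o \<Rightarrow> 'a \<Rightarrow> 'a \<Rightarrow> 'a" where
  "prolong_lift C G A \<iota> P \<pi>0 \<pi>1 =
     pair C (TO C P) (TA C \<pi>0) (TA C \<pi>1) (assoc_lift C G \<iota> \<cdot>\<^bsub>C\<^esub> \<pi>0) (tlift C A \<cdot>\<^bsub>C\<^esub> \<pi>1)"

text \<open>\<open>\<alpha>(v, w) = cw \<circ> 0v \<circ> (c0pw)\<^sup>-\<^sup>1\<close>: the composite is formed in \<open>T\<^sup>2(G)\<close>, with \<open>v\<close> and \<open>w\<close> regarded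
  as generalised elements of \<open>T(G)\<close> and \<open>T\<^sup>2(G)\<close>, and then restricted along \<open>T(\<iota>)\<close>.\<close>

definition alpha ::
    "('o, 'a, 'm) tangent_data_scheme \<Rightarrow> ('o, 'a) groupoid_data \<Rightarrow> 'a \<Rightarrow> 'a \<Rightarrow> 'a \<Rightarrow> 'a" where
  "alpha C G \<iota> \<pi>0 \<pi>1 =
     (let v = \<iota> \<cdot>\<^bsub>C\<^esub> \<pi>0; w = TA C \<iota> \<cdot>\<^bsub>C\<^esub> \<pi>1; c = tflip C (garr G);
          p = tproj C (TO C (garr G)); z = tzero C (TO C (garr G))
      in factor C (TA C \<iota>)
           (gcomp C G 2 (gcomp C G 2 (c \<cdot>\<^bsub>C\<^esub> w) (z \<cdot>\<^bsub>C\<^esub> v))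
              (ginv C G 2 (c \<cdot>\<^bsub>C\<^esub> z \<cdot>\<^bsub>C\<^esub> p \<cdot>\<^bsub>C\<^esub> w))))"

definition bundle_with_lift ::
    "('o, 'a, 'm) tangent_data_scheme \<Rightarrow> 'o \<Rightarrow> 'o \<Rightarrow> 'a \<Rightarrow> 'a \<Rightarrow> bool" where
  "bundle_with_lift C E B q lam \<longleftrightarrow> q \<in> hom C E B \<and> lam \<in> hom C E (TO C E)"

definition linear_bundle_morphism ::
    "('o, 'a, 'm) tangent_data_scheme \<Rightarrow> 'o \<Rightarrow> 'o \<Rightarrow> 'a \<Rightarrow> 'a \<Rightarrow>
       'o \<Rightarrow> 'o \<Rightarrow> 'a \<Rightarrow> 'a \<Rightarrow> 'a \<Rightarrow> 'a \<Rightarrow> bool" where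
  "linear_bundle_morphism C E B q lam E' B' q' lam' f0 f1 \<longleftrightarrow>
     bundle_with_lift C E B q lam \<and> bundle_with_lift C E' B' q' lam' \<and>
     f0 \<in> hom C B B' \<and> f1 \<in> hom C E E' \<and>
     q' \<cdot>\<^bsub>C\<^esub> f1 = f0 \<cdot>\<^bsub>C\<^esub> q \<and>
     TA C f1 \<cdot>\<^bsub>C\<^esub> lam = lam' \<cdot>\<^bsub>C\<^esub> f1"

end

theory Submission
  imports Defs
begin

text \<open>
  Why the claim holds. Write \<open>v\<close>, \<open>w\<close> for the elements of \<open>T(G)\<close> and \<open>T\<^sup>2(G)\<close> underlying the generic
  element of \<open>P\<close>, with \<open>pv = ex\<close>, \<open>T(s)v = 0x\<close>, \<open>T\<^sup>2(s)w = T(0)y\<close>, \<open>T(t)v = y\<close> and \<open>py = x\<close>. The source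
  of \<open>cw\<close> is \<open>cT(0)y = 0y\<close>, the target of \<open>0v\<close>; the sources of \<open>0v\<close> and of \<open>c0pw = T(0)pw\<close> are \<open>00x\<close>
  and \<open>T(0)0x\<close>, which agree (\<open>conjugable_fac\<close>). So \<open>cw \<circ> 0v \<circ> (c0pw)\<^sup>-\<^sup>1\<close> exists.

  Everything else follows from one principle: a natural transformation \<open>T\<^sup>m \<Rightarrow> T\<^sup>n\<close> has components at
  the objects of \<open>G\<close> that respect composition and inverses, and so does \<open>T\<close> itself (\<open>gconj_natural\<close>,
  \<open>gconj_T\<close>). Applying \<open>T(p)\<close> to the composite gives \<open>pw \<circ> T(e)0x \<circ> (pw)\<^sup>-\<^sup>1\<close>, in which the middle
  factor is a unit, hence \<open>T(e)T(t)pw = T(e)\<varrho>p\<pi>\<^sub>1\<close>; and its source is \<open>T\<^sup>2(t)T(0)pw = T(0)\<varrho>p\<pi>\<^sub>1\<close>. So the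
  composite lies in \<open>T(A)\<close>, over \<open>\<varrho>p\<pi>\<^sub>1\<close> (\<open>alpha\<close>).

  For linearity, compare both sides in \<open>T\<^sup>3(G)\<close>, into which \<open>T\<^sup>2(\<iota>)\<close> is monic. On the left, \<open>T\<close> of the
  composite evaluated at \<open>(\<lambda>v, lw)\<close> is \<open>T(c)lw \<circ> T(0)lv \<circ> (T\<^sup>2(0)0pw)\<^sup>-\<^sup>1\<close>, since \<open>T(p)l = 0p\<close>. On the
  right, \<open>cT(l)\<close> is applied to each factor, and \<open>cT(l)c = T(c)l\<close>, \<open>cT(l)0 = T(0)l\<close>,
  \<open>cT(l)T(0) = T\<^sup>2(0)0\<close> turn the factors into the same three elements (\<open>alpha_linear\<close>).
\<close>

section \<open>Arrows, pullbacks and iterates of the tangent functor\<close>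

context category
begin

lemma hom_iff: "f \<in> hom C X Y \<longleftrightarrow> f \<in> Ar C \<and> Dom C f = X \<and> Cod C f = Y"
  by (simp add: hom_def)

lemma
  assumes "f \<in> Ar C" "g \<in> Ar C" "Dom C g = Cod C f"
  shows cmp_Ar: "g \<cdot> f \<in> Ar C"
    and Dom_cmp: "Dom C (g \<cdot> f) = Dom C f"
    and Cod_cmp: "Cod C (g \<cdot> f) = Cod C g"
  using Cmp_hom[of f "Dom C f" "Cod C f" g "Cod C g"] assms by (auto simp: hom_iff)

lemma cmp_assoc:
  assumes "f \<in> Ar C" "g \<in> Ar C" "h \<in> Ar C" "Dom C g = Cod C f" "Dom C h = Cod C g"
  shows "(h \<cdot> g) \<cdot> f = h \<cdot> (g \<cdot> f)"
  using Cmp_assoc[of f "Dom C f" "Cod C f" g "Cod C g" h "Cod C h"] assms by (auto simp: hom_iff)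

lemma Id_cmp: "f \<in> Ar C \<Longrightarrow> Cod C f = Y \<Longrightarrow> Id C Y \<cdot> f = f"
  using Id_Cmp[of f] by (auto simp: hom_iff)

lemma cmp_Id: "f \<in> Ar C \<Longrightarrow> Dom C f = X \<Longrightarrow> f \<cdot> Id C X = f"
  using Cmp_Id[of f] by (auto simp: hom_iff)

lemma
  assumes "X \<in> Ob C"
  shows Id_Ar: "Id C X \<in> Ar C" and Dom_Id: "Dom C (Id C X) = X" and Cod_Id: "Cod C (Id C X) = X"
  using Id_hom[OF assms] by (auto simp: hom_iff)

lemmas cat = cmp_Ar Dom_cmp Cod_cmp cmp_assoc Id_cmp cmp_Id Id_Ar Dom_Id Cod_Id
  Dom_in_Ob Cod_in_Ob

text \<open>Composites are kept nested to the right. The next two lemmas precompose a further arrow \<open>k\<close> to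
  an equation between composites and reassociate; the first does so on both sides.\<close>

lemma cmp_reassoc:
  assumes "g \<cdot> f = g' \<cdot> f'"
    and "f \<in> hom C X Y" "g \<in> hom C Y Z" "f' \<in> hom C X Y'" "g' \<in> hom C Y' Z'" "k \<in> hom C W X"
  shows "g \<cdot> (f \<cdot> k) = g' \<cdot> (f' \<cdot> k)"
  using Cmp_assoc[OF assms(6,2,3)] Cmp_assoc[OF assms(6,4,5)] by (simp add: assms(1))

lemma cmp_left:
  assumes "g \<cdot> f = h"
    and "k \<in> Ar C" "f \<in> Ar C" "g \<in> Ar C" "Dom C f = Cod C k" "Dom C g = Cod C f"
  shows "g \<cdot> (f \<cdot> k) = h \<cdot> k"
  using cmp_assoc[OF assms(2-)] assms(1) by simp

lemma pullback_hom:
  assumes "is_pullback C f g P a b"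
  shows "a \<in> hom C P (Dom C f)" "b \<in> hom C P (Dom C g)" "f \<cdot> a = g \<cdot> b"
  using assms unfolding is_pullback_def by blast+

lemma pullback_pair:
  assumes "is_pullback C f g P a b" and "x \<in> hom C W (Dom C f)" "y \<in> hom C W (Dom C g)"
    and "f \<cdot> x = g \<cdot> y"
  shows "pair C P a b x y \<in> hom C W P"
    and "a \<cdot> pair C P a b x y = x" and "b \<cdot> pair C P a b x y = y"
proof -
  have "\<exists>!u. u \<in> hom C W P \<and> a \<cdot> u = x \<and> b \<cdot> u = y"
    using assms unfolding is_pullback_def by blast
  then have "\<exists>!u. u \<in> hom C (Dom C x) P \<and> a \<cdot> u = x \<and> b \<cdot> u = y"
    using assms(2) by (simp add: hom_iff)
  from theI'[OF this] show "pair C P a b x y \<in> hom C W P"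
    and "a \<cdot> pair C P a b x y = x" and "b \<cdot> pair C P a b x y = y"
    using assms(2) by (auto simp: pair_def hom_iff)
qed

lemma product_pair:
  assumes "is_product C X Y Q a b" and "x \<in> hom C W X" "y \<in> hom C W Y"
  shows "pair C Q a b x y \<in> hom C W Q"
    and "a \<cdot> pair C Q a b x y = x" and "b \<cdot> pair C Q a b x y = y"
proof -
  have "\<exists>!u. u \<in> hom C W Q \<and> a \<cdot> u = x \<and> b \<cdot> u = y"
    using assms unfolding is_product_def by blast
  then have "\<exists>!u. u \<in> hom C (Dom C x) Q \<and> a \<cdot> u = x \<and> b \<cdot> u = y"
    using assms(2) by (simp add: hom_iff)
  from theI'[OF this] show "pair C Q a b x y \<in> hom C W Q"
    and "a \<cdot> pair C Q a b x y = x" and "b \<cdot> pair C Q a b x y = y"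
    using assms(2) by (auto simp: pair_def hom_iff)
qed

lemma product_eqI:
  assumes "is_product C X Y Q a b" and "u \<in> hom C W Q" "u' \<in> hom C W Q"
    and "a \<cdot> u = a \<cdot> u'" "b \<cdot> u = b \<cdot> u'"
  shows "u = u'"
proof -
  have "a \<in> hom C Q X" "b \<in> hom C Q Y"
    using assms(1) unfolding is_product_def by auto
  then have "a \<cdot> u \<in> hom C W X" "b \<cdot> u \<in> hom C W Y"
    using assms(2) Cmp_hom by blast+
  then have "\<exists>!z. z \<in> hom C W Q \<and> a \<cdot> z = a \<cdot> u \<and> b \<cdot> z = b \<cdot> u"
    using assms(1) unfolding is_product_def by blast
  then show ?thesis using assms(2-) by metis
qed

lemma pullback_eqI:
  assumes "is_pullback C f g P a b" and "u \<in> hom C W P" "u' \<in> hom C W P"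
    and "a \<cdot> u = a \<cdot> u'" "b \<cdot> u = b \<cdot> u'"
  shows "u = u'"
proof -
  have *: "a \<in> hom C P (Dom C f)" "b \<in> hom C P (Dom C g)" "f \<cdot> a = g \<cdot> b"
      "f \<in> hom C (Dom C f) (Cod C f)" "g \<in> hom C (Dom C g) (Cod C g)"
    using assms(1) unfolding is_pullback_def by (auto simp: hom_iff)
  then have "a \<cdot> u \<in> hom C W (Dom C f)" "b \<cdot> u \<in> hom C W (Dom C g)"
    using assms(2) Cmp_hom by blast+
  moreover have "f \<cdot> (a \<cdot> u) = g \<cdot> (b \<cdot> u)"
    using cmp_reassoc[OF *(3,1,4,2,5) assms(2)] .
  ultimately have "\<exists>!z. z \<in> hom C W P \<and> a \<cdot> z = a \<cdot> u \<and> b \<cdot> z = b \<cdot> u"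
    using assms(1) unfolding is_pullback_def by blast
  then show ?thesis using assms(2-) by metis
qed

lemma factor_eq:
  assumes "u \<in> hom C W (Dom C m)" "m \<cdot> u = f" "f \<in> hom C W Z"
    and mono: "\<And>u'. u' \<in> hom C W (Dom C m) \<Longrightarrow> m \<cdot> u' = m \<cdot> u \<Longrightarrow> u' = u"
  shows "factor C m f = u"
proof -
  have W: "Dom C f = W" using assms(3) by (simp add: hom_iff)
  show ?thesis
    unfolding factor_def W using assms(1,2) mono by (intro the_equality) blast+
qed

end

context tangent_category
begin

lemma
  assumes "f \<in> Ar C"
  shows T_Ar: "\<T> f \<in> Ar C" and Dom_T: "Dom C (\<T> f) = \<T>\<^sub>o (Dom C f)"
    and Cod_T: "Cod C (\<T> f) = \<T>\<^sub>o (Cod C f)"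
  using T_hom[of f] assms by (auto simp: hom_iff)

lemma T_cmp: "f \<in> Ar C \<Longrightarrow> g \<in> Ar C \<Longrightarrow> Dom C g = Cod C f \<Longrightarrow> \<T> (g \<cdot> f) = \<T> g \<cdot> \<T> f"
  using T_Cmp[of f] by (auto simp: hom_iff)

lemma structure_hom:
  assumes "X \<in> Ob C"
  shows "\<pp> X \<in> hom C (\<T>\<^sub>o X) X" "\<zero> X \<in> hom C X (\<T>\<^sub>o X)" "\<ll> X \<in> hom C (\<T>\<^sub>o X) (\<T>\<^sub>o (\<T>\<^sub>o X))"
    "\<cc> X \<in> hom C (\<T>\<^sub>o (\<T>\<^sub>o X)) (\<T>\<^sub>o (\<T>\<^sub>o X))"
  using assms natural_p natural_0 natural_l natural_c unfolding natural_def by auto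

lemma structure_Ar:
  assumes "X \<in> Ob C"
  shows "\<pp> X \<in> Ar C" "Dom C (\<pp> X) = \<T>\<^sub>o X" "Cod C (\<pp> X) = X"
    "\<zero> X \<in> Ar C" "Dom C (\<zero> X) = X" "Cod C (\<zero> X) = \<T>\<^sub>o X"
    "\<ll> X \<in> Ar C" "Dom C (\<ll> X) = \<T>\<^sub>o X" "Cod C (\<ll> X) = \<T>\<^sub>o (\<T>\<^sub>o X)"
    "\<cc> X \<in> Ar C" "Dom C (\<cc> X) = \<T>\<^sub>o (\<T>\<^sub>o X)" "Cod C (\<cc> X) = \<T>\<^sub>o (\<T>\<^sub>o X)"
  using structure_hom[OF assms] by (auto simp: hom_iff)

lemmas tcat = cat T_Ar Dom_T Cod_T T_cmp T_Id T_Ob structure_Ar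

lemma naturality:
  assumes "f \<in> hom C X Y"
  shows p_nat: "\<pp> Y \<cdot> \<T> f = f \<cdot> \<pp> X" and zero_nat: "\<zero> Y \<cdot> f = \<T> f \<cdot> \<zero> X"
    and l_nat: "\<ll> Y \<cdot> \<T> f = \<T> (\<T> f) \<cdot> \<ll> X"
    and c_nat: "\<cc> Y \<cdot> \<T> (\<T> f) = \<T> (\<T> f) \<cdot> \<cc> X"
  using assms natural_p natural_0 natural_l natural_c unfolding natural_def by metis+

lemma
  assumes "f \<in> hom C X Y" "k \<in> hom C W (\<T>\<^sub>o X)"
  shows p_nat': "\<pp> Y \<cdot> \<T> f \<cdot> k = f \<cdot> \<pp> X \<cdot> k"
    and l_nat': "\<ll> Y \<cdot> \<T> f \<cdot> k = \<T> (\<T> f) \<cdot> \<ll> X \<cdot> k"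
proof -
  have X: "X \<in> Ob C" "Y \<in> Ob C" using assms(1) by (auto simp: hom_iff Dom_in_Ob Cod_in_Ob)
  show "\<pp> Y \<cdot> \<T> f \<cdot> k = f \<cdot> \<pp> X \<cdot> k"
    by (rule cmp_reassoc[OF p_nat[OF assms(1)] T_hom[OF assms(1)] structure_hom(1)[OF X(2)]
          structure_hom(1)[OF X(1)] assms])
  show "\<ll> Y \<cdot> \<T> f \<cdot> k = \<T> (\<T> f) \<cdot> \<ll> X \<cdot> k"
    by (rule cmp_reassoc[OF l_nat[OF assms(1)] T_hom[OF assms(1)] structure_hom(3)[OF X(2)]
          structure_hom(3)[OF X(1)] T_hom[OF T_hom[OF assms(1)]] assms(2)])
qed

lemma zero_nat':
  assumes "f \<in> hom C X Y" "k \<in> hom C W X"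
  shows "\<zero> Y \<cdot> f \<cdot> k = \<T> f \<cdot> \<zero> X \<cdot> k"
proof -
  have X: "X \<in> Ob C" "Y \<in> Ob C" using assms(1) by (auto simp: hom_iff Dom_in_Ob Cod_in_Ob)
  show ?thesis
    by (rule cmp_reassoc[OF zero_nat[OF assms(1)] assms(1) structure_hom(2)[OF X(2)]
          structure_hom(2)[OF X(1)] T_hom[OF assms(1)] assms(2)])
qed

lemma c_nat':
  assumes "f \<in> hom C X Y" "k \<in> hom C W (\<T>\<^sub>o (\<T>\<^sub>o X))"
  shows "\<cc> Y \<cdot> \<T> (\<T> f) \<cdot> k = \<T> (\<T> f) \<cdot> \<cc> X \<cdot> k"
proof -
  have X: "X \<in> Ob C" "Y \<in> Ob C" using assms(1) by (auto simp: hom_iff Dom_in_Ob Cod_in_Ob)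
  show ?thesis
    by (rule cmp_reassoc[OF c_nat[OF assms(1)] T_hom[OF T_hom[OF assms(1)]] structure_hom(4)[OF X(2)]
          structure_hom(4)[OF X(1)] T_hom[OF T_hom[OF assms(1)]] assms(2)])
qed

lemma structure_eqs:
  assumes "X \<in> Ob C"
  shows p_zero: "\<pp> X \<cdot> \<zero> X = Id C X"
    and Tp_l: "\<T> (\<pp> X) \<cdot> \<ll> X = \<zero> X \<cdot> \<pp> X"
    and l_zero: "\<ll> X \<cdot> \<zero> X = \<T> (\<zero> X) \<cdot> \<zero> X"
    and p_c: "\<pp> (\<T>\<^sub>o X) \<cdot> \<cc> X = \<T> (\<pp> X)"
    and c_Tzero: "\<cc> X \<cdot> \<T> (\<zero> X) = \<zero> (\<T>\<^sub>o X)"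
proof -
  note d = additive_bundle_def additive_bundle_morphism_def tangent_bundle_def T_bundle_def
  show "\<pp> X \<cdot> \<zero> X = Id C X" using additive_p[OF assms] by (simp add: d)
  show "\<T> (\<pp> X) \<cdot> \<ll> X = \<zero> X \<cdot> \<pp> X" using additive_l[OF assms] by (simp add: d)
  show "\<ll> X \<cdot> \<zero> X = \<T> (\<zero> X) \<cdot> \<zero> X" using additive_l[OF assms] by (simp add: d)
  show "\<pp> (\<T>\<^sub>o X) \<cdot> \<cc> X = \<T> (\<pp> X)"
    using additive_c[OF assms] assms by (simp add: d tcat)
  show "\<cc> X \<cdot> \<T> (\<zero> X) = \<zero> (\<T>\<^sub>o X)"
    using additive_c[OF assms] assms by (simp add: d tcat)
qed

lemma c_zero:
  assumes "X \<in> Ob C"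
  shows "\<cc> X \<cdot> \<zero> (\<T>\<^sub>o X) = \<T> (\<zero> X)"
proof -
  have "\<cc> X \<cdot> \<zero> (\<T>\<^sub>o X) = (\<cc> X \<cdot> \<cc> X) \<cdot> \<T> (\<zero> X)"
    using assms by (simp add: tcat c_Tzero[symmetric])
  then show ?thesis using assms by (simp add: c_c tcat)
qed

lemma Tp_c:
  assumes "X \<in> Ob C"
  shows "\<T> (\<pp> X) \<cdot> \<cc> X = \<pp> (\<T>\<^sub>o X)"
proof -
  have "\<T> (\<pp> X) \<cdot> \<cc> X = \<pp> (\<T>\<^sub>o X) \<cdot> (\<cc> X \<cdot> \<cc> X)"
    using assms by (simp add: tcat p_c[symmetric])
  then show ?thesis using assms by (simp add: c_c tcat)
qed

text \<open>The compatibility of \<open>c\<close> and \<open>l\<close>, solved for \<open>T(c)l\<close>.\<close>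

lemma c_Tl_c:
  assumes "X \<in> Ob C"
  shows "\<cc> (\<T>\<^sub>o X) \<cdot> \<T> (\<ll> X) \<cdot> \<cc> X = \<T> (\<cc> X) \<cdot> \<ll> (\<T>\<^sub>o X)"
proof -
  have "\<cc> (\<T>\<^sub>o X) \<cdot> \<T> (\<ll> X) \<cdot> \<cc> X = (\<cc> (\<T>\<^sub>o X) \<cdot> \<cc> (\<T>\<^sub>o X)) \<cdot> \<T> (\<cc> X) \<cdot> \<ll> (\<T>\<^sub>o X)"
    using assms by (simp add: tcat c_Tc_l[symmetric])
  then show ?thesis using assms by (simp add: c_c tcat)
qed

lemma Tn_Ob: "X \<in> Ob C \<Longrightarrow> (\<T>\<^sub>o ^^ n) X \<in> Ob C"
  by (induction n) (auto simp: T_Ob)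

lemma Tn_hom: "f \<in> hom C X Y \<Longrightarrow> (\<T> ^^ n) f \<in> hom C ((\<T>\<^sub>o ^^ n) X) ((\<T>\<^sub>o ^^ n) Y)"
  by (induction n) (auto simp: T_hom)

lemma Tn_Ar:
  assumes "f \<in> Ar C"
  shows "(\<T> ^^ n) f \<in> Ar C" "Dom C ((\<T> ^^ n) f) = (\<T>\<^sub>o ^^ n) (Dom C f)"
    "Cod C ((\<T> ^^ n) f) = (\<T>\<^sub>o ^^ n) (Cod C f)"
  using Tn_hom[of f] assms by (auto simp: hom_iff)

lemma Tn_Cmp:
  "f \<in> hom C X Y \<Longrightarrow> g \<in> hom C Y Z \<Longrightarrow> (\<T> ^^ n) (g \<cdot> f) = (\<T> ^^ n) g \<cdot> (\<T> ^^ n) f"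
proof (induction n)
  case (Suc n)
  show ?case using Suc.IH[OF Suc.prems] T_Cmp[OF Tn_hom[OF Suc.prems(1)] Tn_hom[OF Suc.prems(2)]]
    by simp
qed simp

lemma Tn_Id: "X \<in> Ob C \<Longrightarrow> (\<T> ^^ n) (Id C X) = Id C ((\<T>\<^sub>o ^^ n) X)"
  by (induction n) (auto simp: T_Id Tn_Ob)

end

section \<open>The groupoid operations on iterated tangent bundles\<close>

context groupoid
begin

lemma groupoid_Ar:
  "gsrc G \<in> Ar C" "Dom C (gsrc G) = garr G" "Cod C (gsrc G) = gobj G"
  "gtgt G \<in> Ar C" "Dom C (gtgt G) = garr G" "Cod C (gtgt G) = gobj G"
  "gunit G \<in> Ar C" "Dom C (gunit G) = gobj G" "Cod C (gunit G) = garr G"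
  "ginverse G \<in> Ar C" "Dom C (ginverse G) = garr G" "Cod C (ginverse G) = garr G"
  "gmult G \<in> Ar C" "Dom C (gmult G) = gpairs G" "Cod C (gmult G) = garr G"
  using gsrc gtgt gunit ginverse gmult by (auto simp: hom_iff)

lemmas gcat = tcat groupoid_Ar gobj garr

lemma gpairs_pullback:
  "is_pullback C ((\<T> ^^ n) (gsrc G)) ((\<T> ^^ n) (gtgt G)) ((\<T>\<^sub>o ^^ n) (gpairs G))
     ((\<T> ^^ n) (gfst G)) ((\<T> ^^ n) (gsnd G))"
  using gpairs unfolding T_pullback_def by blast

lemma gfst_gsnd_hom:
  "gfst G \<in> hom C (gpairs G) (garr G)" "gsnd G \<in> hom C (gpairs G) (garr G)"
  using pullback_hom[OF gpairs_pullback[of 0]] by (simp_all add: groupoid_Ar)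

text \<open>\<open>composable n X g h\<close>: the elements \<open>g\<close>, \<open>h\<close> of \<open>T\<^sup>n(G)\<close>, defined at stage \<open>X\<close>, satisfy
  \<open>T\<^sup>n(s) g = T\<^sup>n(t) h\<close>, so that \<open>g \<circ> h\<close> is meaningful.\<close>

definition composable :: "nat \<Rightarrow> 'o \<Rightarrow> 'a \<Rightarrow> 'a \<Rightarrow> bool" where
  "composable n X g h \<longleftrightarrow> g \<in> hom C X ((\<T>\<^sub>o ^^ n) (garr G)) \<and> h \<in> hom C X ((\<T>\<^sub>o ^^ n) (garr G)) \<and>
     (\<T> ^^ n) (gsrc G) \<cdot> g = (\<T> ^^ n) (gtgt G) \<cdot> h"

text \<open>The element \<open>(g, h)\<close> of the object of composable pairs, at level \<open>T\<^sup>n\<close>.\<close>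

abbreviation gpair :: "nat \<Rightarrow> 'a \<Rightarrow> 'a \<Rightarrow> 'a" where
  "gpair n \<equiv> pair C ((\<T>\<^sub>o ^^ n) (gpairs G)) ((\<T> ^^ n) (gfst G)) ((\<T> ^^ n) (gsnd G))"

lemma gpair:
  assumes "composable n X g h"
  shows "gpair n g h \<in> hom C X ((\<T>\<^sub>o ^^ n) (gpairs G))"
    and "(\<T> ^^ n) (gfst G) \<cdot> gpair n g h = g" and "(\<T> ^^ n) (gsnd G) \<cdot> gpair n g h = h"
  using pullback_pair[OF gpairs_pullback, of g X n h] assms
  by (simp_all add: composable_def Tn_Ar groupoid_Ar)

lemma gpair_eq:
  assumes "composable n X g h" and "u \<in> hom C X ((\<T>\<^sub>o ^^ n) (gpairs G))"
    and "(\<T> ^^ n) (gfst G) \<cdot> u = g" and "(\<T> ^^ n) (gsnd G) \<cdot> u = h"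
  shows "u = gpair n g h"
  using pullback_eqI[OF gpairs_pullback assms(2) gpair(1)[OF assms(1)]] gpair[OF assms(1)] assms(3,4)
  by simp

lemma gcomp_hom: "composable n X g h \<Longrightarrow> gcomp C G n g h \<in> hom C X ((\<T>\<^sub>o ^^ n) (garr G))"
  unfolding gcomp_def by (rule Cmp_hom[OF gpair(1) Tn_hom[OF gmult]])

lemma gcomp_src:
  assumes "composable n X g h"
  shows "(\<T> ^^ n) (gsrc G) \<cdot> gcomp C G n g h = (\<T> ^^ n) (gsrc G) \<cdot> h"
proof -
  have "(\<T> ^^ n) (gsrc G) \<cdot> (\<T> ^^ n) (gmult G) = (\<T> ^^ n) (gsrc G) \<cdot> (\<T> ^^ n) (gsnd G)"
    using Tn_Cmp[OF gmult gsrc] Tn_Cmp[OF gfst_gsnd_hom(2) gsrc] src_mult by metis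
  from cmp_reassoc[OF this Tn_hom[OF gmult] Tn_hom[OF gsrc] Tn_hom[OF gfst_gsnd_hom(2)]
      Tn_hom[OF gsrc] gpair(1)[OF assms]]
  show ?thesis by (simp add: gcomp_def gpair[OF assms])
qed

lemma ginv_hom: "g \<in> hom C X ((\<T>\<^sub>o ^^ n) (garr G)) \<Longrightarrow> ginv C G n g \<in> hom C X ((\<T>\<^sub>o ^^ n) (garr G))"
  unfolding ginv_def by (rule Cmp_hom[OF _ Tn_hom[OF ginverse]])

lemma
  assumes "g \<in> hom C X ((\<T>\<^sub>o ^^ n) (garr G))"
  shows ginv_src: "(\<T> ^^ n) (gsrc G) \<cdot> ginv C G n g = (\<T> ^^ n) (gtgt G) \<cdot> g"
    and ginv_tgt: "(\<T> ^^ n) (gtgt G) \<cdot> ginv C G n g = (\<T> ^^ n) (gsrc G) \<cdot> g"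
  using Tn_Cmp[OF ginverse gsrc, of n] Tn_Cmp[OF ginverse gtgt, of n] assms
    Cmp_assoc[OF assms Tn_hom[OF ginverse] Tn_hom[OF gsrc]]
    Cmp_assoc[OF assms Tn_hom[OF ginverse] Tn_hom[OF gtgt]]
  by (auto simp: ginv_def src_inv tgt_inv)

text \<open>Naturality makes every transformation between iterates of \<open>T\<close> a groupoid homomorphism.\<close>

lemma gcomp_natural:
  assumes \<eta>: "natural C (\<T>\<^sub>o ^^ m) (\<T> ^^ m) (\<T>\<^sub>o ^^ n) (\<T> ^^ n) \<eta>"
    and gh: "composable m X g h"
  shows "\<eta> (garr G) \<cdot> gcomp C G m g h =
      gcomp C G n (\<eta> (garr G) \<cdot> g) (\<eta> (garr G) \<cdot> h)"
proof -
  have \<eta>h: "\<eta> Y \<in> hom C ((\<T>\<^sub>o ^^ m) Y) ((\<T>\<^sub>o ^^ n) Y)" if "Y \<in> Ob C" for Y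
    using \<eta> that by (simp add: natural_def)
  have swap: "(\<T> ^^ n) f \<cdot> \<eta> Y \<cdot> k = \<eta> Z \<cdot> (\<T> ^^ m) f \<cdot> k"
    if f: "f \<in> hom C Y Z" and k: "k \<in> hom C W ((\<T>\<^sub>o ^^ m) Y)" for f Y Z k W
  proof -
    have ob: "Y \<in> Ob C" "Z \<in> Ob C" using f by (auto simp: hom_iff Dom_in_Ob Cod_in_Ob)
    have "(\<T> ^^ n) f \<cdot> \<eta> Y = \<eta> Z \<cdot> (\<T> ^^ m) f"
      using \<eta> f by (simp add: natural_def)
    from cmp_reassoc[OF this \<eta>h[OF ob(1)] Tn_hom[OF f] Tn_hom[OF f] \<eta>h[OF ob(2)] k] show ?thesis .
  qed
  have g: "g \<in> hom C X ((\<T>\<^sub>o ^^ m) (garr G))" and h: "h \<in> hom C X ((\<T>\<^sub>o ^^ m) (garr G))"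
    and eq: "(\<T> ^^ m) (gsrc G) \<cdot> g = (\<T> ^^ m) (gtgt G) \<cdot> h"
    using gh by (auto simp: composable_def)
  have comp: "composable n X (\<eta> (garr G) \<cdot> g) (\<eta> (garr G) \<cdot> h)"
    using Cmp_hom[OF g \<eta>h[OF garr]] Cmp_hom[OF h \<eta>h[OF garr]] swap[OF gsrc g] swap[OF gtgt h] eq
    by (simp add: composable_def)
  have ob: "gpairs G \<in> Ob C" using Dom_in_Ob[of "gmult G"] by (simp add: groupoid_Ar)
  note u = gpair[OF gh]
  have "\<eta> (gpairs G) \<cdot> gpair m g h = gpair n (\<eta> (garr G) \<cdot> g) (\<eta> (garr G) \<cdot> h)"
    using gpair_eq[OF comp Cmp_hom[OF u(1) \<eta>h[OF ob]]] swap[OF gfst_gsnd_hom(1) u(1)]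
      swap[OF gfst_gsnd_hom(2) u(1)] u by simp
  then show "\<eta> (garr G) \<cdot> gcomp C G m g h = gcomp C G n (\<eta> (garr G) \<cdot> g) (\<eta> (garr G) \<cdot> h)"
    using swap[OF gmult u(1)] by (simp add: gcomp_def)
qed

lemma ginv_natural:
  assumes \<eta>: "natural C (\<T>\<^sub>o ^^ m) (\<T> ^^ m) (\<T>\<^sub>o ^^ n) (\<T> ^^ n) \<eta>"
    and g: "g \<in> hom C X ((\<T>\<^sub>o ^^ m) (garr G))"
  shows "\<eta> (garr G) \<cdot> ginv C G m g = ginv C G n (\<eta> (garr G) \<cdot> g)"
proof -
  have \<eta>h: "\<eta> (garr G) \<in> hom C ((\<T>\<^sub>o ^^ m) (garr G)) ((\<T>\<^sub>o ^^ n) (garr G))"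
    using \<eta> garr by (simp add: natural_def)
  have "\<eta> (garr G) \<cdot> (\<T> ^^ m) (ginverse G) = (\<T> ^^ n) (ginverse G) \<cdot> \<eta> (garr G)"
    using \<eta> ginverse by (simp add: natural_def)
  from cmp_reassoc[OF this Tn_hom[OF ginverse] \<eta>h \<eta>h Tn_hom[OF ginverse] g]
  show ?thesis by (simp add: ginv_def)
qed

text \<open>The operations on \<open>T\<^sup>n\<^sup>+\<^sup>1(G)\<close> are the image under \<open>T\<close> of those on \<open>T\<^sup>n(G)\<close>.\<close>

lemma gcomp_T:
  assumes gh: "composable n X g h" and k: "k \<in> hom C W (\<T>\<^sub>o X)"
  shows "\<T> (gcomp C G n g h) \<cdot> k = gcomp C G (Suc n) (\<T> g \<cdot> k) (\<T> h \<cdot> k)"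
proof -
  have g: "g \<in> hom C X ((\<T>\<^sub>o ^^ n) (garr G))" and h: "h \<in> hom C X ((\<T>\<^sub>o ^^ n) (garr G))"
    and eq: "(\<T> ^^ n) (gsrc G) \<cdot> g = (\<T> ^^ n) (gtgt G) \<cdot> h"
    using gh by (auto simp: composable_def)
  have split: "\<T> (f \<cdot> x) \<cdot> k = \<T> f \<cdot> \<T> x \<cdot> k"
    if x: "x \<in> hom C X Y" and f: "f \<in> hom C Y Z" for f x Y Z
    using T_Cmp[OF x f] Cmp_assoc[OF k T_hom[OF x] T_hom[OF f]] by simp
  have comp: "composable (Suc n) W (\<T> g \<cdot> k) (\<T> h \<cdot> k)"
    using Cmp_hom[OF k T_hom[OF g]] Cmp_hom[OF k T_hom[OF h]] split[OF g Tn_hom[OF gsrc]]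
      split[OF h Tn_hom[OF gtgt]] eq
    by (simp add: composable_def)
  note u = gpair[OF gh]
  have "\<T> (gpair n g h) \<cdot> k = gpair (Suc n) (\<T> g \<cdot> k) (\<T> h \<cdot> k)"
    using gpair_eq[OF comp, of "\<T> (gpair n g h) \<cdot> k"] Cmp_hom[OF k T_hom[OF u(1)]]
      split[OF u(1) Tn_hom[OF gfst_gsnd_hom(1)]] split[OF u(1) Tn_hom[OF gfst_gsnd_hom(2)]] u(2,3)
    by simp
  then show "\<T> (gcomp C G n g h) \<cdot> k = gcomp C G (Suc n) (\<T> g \<cdot> k) (\<T> h \<cdot> k)"
    using split[OF u(1) Tn_hom[OF gmult]] by (simp add: gcomp_def)
qed

lemma ginv_T:
  assumes g: "g \<in> hom C X ((\<T>\<^sub>o ^^ n) (garr G))" and k: "k \<in> hom C W (\<T>\<^sub>o X)"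
  shows "\<T> (ginv C G n g) \<cdot> k = ginv C G (Suc n) (\<T> g \<cdot> k)"
  using T_Cmp[OF g Tn_hom[OF ginverse]] Cmp_assoc[OF k T_hom[OF g] T_hom[OF Tn_hom[OF ginverse]]]
  by (simp add: ginv_def)

text \<open>The unit and inverse laws of \<open>G\<close> hold in every \<open>T\<^sup>n(G)\<close>, by induction on \<open>n\<close>: the law for the
  generic element of \<open>T\<^sup>n(G)\<close> is carried by \<open>T\<close> to the one for the generic element of
  \<open>T\<^sup>n\<^sup>+\<^sup>1(G)\<close>.\<close>

lemma gcomp_unit:
  assumes "g \<in> hom C X ((\<T>\<^sub>o ^^ n) (garr G))"
  shows "gcomp C G n g ((\<T> ^^ n) (gunit G) \<cdot> (\<T> ^^ n) (gsrc G) \<cdot> g) = g"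
  using assms
proof (induction n arbitrary: g X)
  case 0
  then show ?case using mult_unit by simp
next
  case (Suc n)
  let ?A = "(\<T>\<^sub>o ^^ n) (garr G)" and ?e = "(\<T> ^^ n) (gunit G)" and ?s = "(\<T> ^^ n) (gsrc G)"
    and ?t = "(\<T> ^^ n) (gtgt G)"
  have ob: "?A \<in> Ob C" by (simp add: Tn_Ob garr)
  have te: "?t \<cdot> ?e = Id C ((\<T>\<^sub>o ^^ n) (gobj G))"
    using Tn_Cmp[OF gunit gtgt, of n] by (simp add: tgt_unit Tn_Id gobj)
  note tn = Tn_Ar gcat Tn_Ob
  have "?t \<cdot> ?e \<cdot> ?s = ?s"
    using cmp_assoc[of ?s ?e ?t] te by (simp add: tn)
  then have comp: "composable n ?A (Id C ?A) (?e \<cdot> ?s)"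
    using ob by (simp add: composable_def hom_iff tn)
  have "gcomp C G n (Id C ?A) (?e \<cdot> ?s \<cdot> Id C ?A) = Id C ?A"
    using Suc.IH[OF Id_hom[OF ob]] .
  then have "gcomp C G n (Id C ?A) (?e \<cdot> ?s) = Id C ?A" by (simp add: tn)
  then have T: "\<T> (Id C ?A) \<cdot> g = gcomp C G (Suc n) (\<T> (Id C ?A) \<cdot> g) (\<T> (?e \<cdot> ?s) \<cdot> g)"
    using gcomp_T[OF comp, of g X] Suc.prems by simp
  have I1: "\<T> (Id C ?A) \<cdot> g = g"
    and I2: "\<T> (?e \<cdot> ?s) \<cdot> g = (\<T> ^^ Suc n) (gunit G) \<cdot> (\<T> ^^ Suc n) (gsrc G) \<cdot> g"
    using Suc.prems by (simp_all add: tn hom_iff)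
  show ?case using T[unfolded I1 I2] by (rule sym)
qed

lemma gcomp_ginv:
  assumes "g \<in> hom C X ((\<T>\<^sub>o ^^ n) (garr G))"
  shows "gcomp C G n g (ginv C G n g) = (\<T> ^^ n) (gunit G) \<cdot> (\<T> ^^ n) (gtgt G) \<cdot> g"
  using assms
proof (induction n arbitrary: g X)
  case 0
  then show ?case using mult_inv by simp
next
  case (Suc n)
  let ?A = "(\<T>\<^sub>o ^^ n) (garr G)" and ?e = "(\<T> ^^ n) (gunit G)" and ?t = "(\<T> ^^ n) (gtgt G)"
  have ob: "?A \<in> Ob C" by (simp add: Tn_Ob garr)
  note I = Id_hom[OF ob]
  note tn = Tn_Ar gcat Tn_Ob
  have comp: "composable n ?A (Id C ?A) (ginv C G n (Id C ?A))"
    using I ginv_hom[OF I] ginv_tgt[OF I] by (simp add: composable_def)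
  have "gcomp C G n (Id C ?A) (ginv C G n (Id C ?A)) = ?e \<cdot> ?t"
    using Suc.IH[OF I] by (simp add: tn)
  then have "\<T> (?e \<cdot> ?t) \<cdot> g =
      gcomp C G (Suc n) (\<T> (Id C ?A) \<cdot> g) (\<T> (ginv C G n (Id C ?A)) \<cdot> g)"
    using gcomp_T[OF comp, of g X] Suc.prems by simp
  also have "\<dots> = gcomp C G (Suc n) (\<T> (Id C ?A) \<cdot> g) (ginv C G (Suc n) (\<T> (Id C ?A) \<cdot> g))"
    using ginv_T[OF I, of g X] Suc.prems by simp
  finally have T: "\<T> (?e \<cdot> ?t) \<cdot> g =
      gcomp C G (Suc n) (\<T> (Id C ?A) \<cdot> g) (ginv C G (Suc n) (\<T> (Id C ?A) \<cdot> g))" .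
  have I1: "\<T> (Id C ?A) \<cdot> g = g"
    and I2: "\<T> (?e \<cdot> ?t) \<cdot> g = (\<T> ^^ Suc n) (gunit G) \<cdot> (\<T> ^^ Suc n) (gtgt G) \<cdot> g"
    using Suc.prems by (simp_all add: tn hom_iff)
  show ?case using T[unfolded I1 I2] by (rule sym)
qed

text \<open>\<open>gconj n a b d\<close> is \<open>a \<circ> b \<circ> d\<^sup>-\<^sup>1\<close>, bracketed to the left. It is meaningful when the source of
  \<open>a\<close> is the target of \<open>b\<close>, and \<open>b\<close> and \<open>d\<close> have the same source; this is \<open>conjugable n X a b d\<close>
  for elements at stage \<open>X\<close>.\<close>

definition gconj :: "nat \<Rightarrow> 'a \<Rightarrow> 'a \<Rightarrow> 'a \<Rightarrow> 'a" where
  "gconj n a b d = gcomp C G n (gcomp C G n a b) (ginv C G n d)"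

definition conjugable :: "nat \<Rightarrow> 'o \<Rightarrow> 'a \<Rightarrow> 'a \<Rightarrow> 'a \<Rightarrow> bool" where
  "conjugable n X a b d \<longleftrightarrow> composable n X a b \<and> d \<in> hom C X ((\<T>\<^sub>o ^^ n) (garr G)) \<and>
     (\<T> ^^ n) (gsrc G) \<cdot> b = (\<T> ^^ n) (gsrc G) \<cdot> d"

lemma conjugable_composable:
  assumes "conjugable n X a b d"
  shows "composable n X (gcomp C G n a b) (ginv C G n d)"
proof -
  have ab: "composable n X a b" and d: "d \<in> hom C X ((\<T>\<^sub>o ^^ n) (garr G))"
    and eq: "(\<T> ^^ n) (gsrc G) \<cdot> b = (\<T> ^^ n) (gsrc G) \<cdot> d"
    using assms by (auto simp: conjugable_def)
  show ?thesis
    using gcomp_hom[OF ab] ginv_hom[OF d] eq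
    by (simp add: composable_def gcomp_src[OF ab] ginv_tgt[OF d])
qed

lemma gconj_hom: "conjugable n X a b d \<Longrightarrow> gconj n a b d \<in> hom C X ((\<T>\<^sub>o ^^ n) (garr G))"
  unfolding gconj_def using gcomp_hom conjugable_composable by blast

lemma gconj_src:
  assumes "conjugable n X a b d"
  shows "(\<T> ^^ n) (gsrc G) \<cdot> gconj n a b d = (\<T> ^^ n) (gtgt G) \<cdot> d"
proof -
  have "d \<in> hom C X ((\<T>\<^sub>o ^^ n) (garr G))" using assms by (auto simp: conjugable_def)
  from ginv_src[OF this] show ?thesis
    unfolding gconj_def by (simp add: gcomp_src[OF conjugable_composable[OF assms]])
qed

lemma gconj_natural:
  assumes \<eta>: "natural C (\<T>\<^sub>o ^^ m) (\<T> ^^ m) (\<T>\<^sub>o ^^ n) (\<T> ^^ n) \<eta>"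
    and "conjugable m X a b d"
  shows "\<eta> (garr G) \<cdot> gconj m a b d = gconj n (\<eta> (garr G) \<cdot> a) (\<eta> (garr G) \<cdot> b) (\<eta> (garr G) \<cdot> d)"
proof -
  have "composable m X a b" "d \<in> hom C X ((\<T>\<^sub>o ^^ m) (garr G))"
    using assms(2) by (auto simp: conjugable_def)
  then show ?thesis
    using gcomp_natural[OF \<eta> conjugable_composable[OF assms(2)]]
    by (simp add: gconj_def gcomp_natural[OF \<eta>] ginv_natural[OF \<eta>])
qed

lemma gconj_T:
  assumes "conjugable n X a b d" and k: "k \<in> hom C W (\<T>\<^sub>o X)"
  shows "\<T> (gconj n a b d) \<cdot> k = gconj (Suc n) (\<T> a \<cdot> k) (\<T> b \<cdot> k) (\<T> d \<cdot> k)"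
proof -
  have "composable n X a b" "d \<in> hom C X ((\<T>\<^sub>o ^^ n) (garr G))"
    using assms(1) by (auto simp: conjugable_def)
  then show ?thesis
    using gcomp_T[OF conjugable_composable[OF assms(1)] k]
    by (simp add: gconj_def gcomp_T[OF _ k] ginv_T[OF _ k])
qed

lemma gconj_unit:
  assumes "g \<in> hom C X ((\<T>\<^sub>o ^^ n) (garr G))"
  shows "gconj n g ((\<T> ^^ n) (gunit G) \<cdot> (\<T> ^^ n) (gsrc G) \<cdot> g) g =
    (\<T> ^^ n) (gunit G) \<cdot> (\<T> ^^ n) (gtgt G) \<cdot> g"
  by (simp add: gconj_def gcomp_unit[OF assms] gcomp_ginv[OF assms])

end


section \<open>The associated bundle and its prolongation\<close>

text \<open>A groupoid with a chosen associated bundle \<open>A\<close>, and a chosen prolongation \<open>P\<close> of it.\<close>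

locale groupoid_prolongation = groupoid C G
  for C :: "('o, 'a, 'm) tangent_data_scheme" (structure) and G :: "('o, 'a) groupoid_data" +
  fixes A :: 'o and \<pi> \<iota> :: 'a and P :: 'o and \<pi>\<^sub>0 \<pi>\<^sub>1 :: 'a
  assumes assoc: "associated_bundle C G A \<pi> \<iota>"
    and prolong: "prolongation C G \<pi> \<iota> P \<pi>\<^sub>0 \<pi>\<^sub>1"
begin

text \<open>The defining equations of \<open>A\<close> and the universal property of \<open>T\<^sup>n(A)\<close>, with the product
  \<open>G \<times> T(M)\<close> eliminated: \<open>T\<^sup>n(A)\<close> consists of the elements of \<open>T\<^sup>n\<^sup>+\<^sup>1(G)\<close> that satisfy
  the two equations defining \<open>A\<close>.\<close>

lemma assoc_pullback:
  shows iota_hom: "\<iota> \<in> hom C A (\<T>\<^sub>o (garr G))" and pi_hom: "\<pi> \<in> hom C A (gobj G)"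
    and p_iota: "\<pp> (garr G) \<cdot> \<iota> = gunit G \<cdot> \<pi>"
    and Ts_iota: "\<T> (gsrc G) \<cdot> \<iota> = \<zero> (gobj G) \<cdot> \<pi>"
    and into_TnA: "\<And>n W x y. x \<in> hom C W ((\<T>\<^sub>o ^^ n) (\<T>\<^sub>o (garr G))) \<Longrightarrow>
      y \<in> hom C W ((\<T>\<^sub>o ^^ n) (gobj G)) \<Longrightarrow>
      (\<T> ^^ n) (\<pp> (garr G)) \<cdot> x = (\<T> ^^ n) (gunit G) \<cdot> y \<Longrightarrow>
      (\<T> ^^ n) (\<T> (gsrc G)) \<cdot> x = (\<T> ^^ n) (\<zero> (gobj G)) \<cdot> y \<Longrightarrow>
      \<exists>u. u \<in> hom C W ((\<T>\<^sub>o ^^ n) A) \<and> (\<T> ^^ n) \<iota> \<cdot> u = x \<and> (\<T> ^^ n) \<pi> \<cdot> u = y"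
    and Tn_iota_mono: "\<And>n W u u'. u \<in> hom C W ((\<T>\<^sub>o ^^ n) A) \<Longrightarrow> u' \<in> hom C W ((\<T>\<^sub>o ^^ n) A) \<Longrightarrow>
      (\<T> ^^ n) \<iota> \<cdot> u = (\<T> ^^ n) \<iota> \<cdot> u' \<Longrightarrow> u = u'"
proof -
  from assoc obtain Q q0 q1 where
    prod: "T_product C (garr G) (\<T>\<^sub>o (gobj G)) Q q0 q1" and
    pb: "T_pullback C (pair C Q q0 q1 (\<pp> (garr G)) (\<T> (gsrc G)))
          (pair C Q q0 q1 (gunit G) (\<zero> (gobj G))) A \<iota> \<pi>"
    unfolding associated_bundle_def by blast
  define k1 where "k1 = pair C Q q0 q1 (\<pp> (garr G)) (\<T> (gsrc G))"
  define k2 where "k2 = pair C Q q0 q1 (gunit G) (\<zero> (gobj G))"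
  have prodn: "is_product C ((\<T>\<^sub>o ^^ n) (garr G)) ((\<T>\<^sub>o ^^ n) (\<T>\<^sub>o (gobj G))) ((\<T>\<^sub>o ^^ n) Q)
      ((\<T> ^^ n) q0) ((\<T> ^^ n) q1)" for n
    using prod unfolding T_product_def by blast
  have pbn: "is_pullback C ((\<T> ^^ n) k1) ((\<T> ^^ n) k2) ((\<T>\<^sub>o ^^ n) A) ((\<T> ^^ n) \<iota>) ((\<T> ^^ n) \<pi>)" for n
    using pb unfolding T_pullback_def k1_def k2_def by blast
  have q: "q0 \<in> hom C Q (garr G)" "q1 \<in> hom C Q (\<T>\<^sub>o (gobj G))"
    using prodn[of 0] by (simp_all add: is_product_def)
  note p = structure_hom(1)[OF garr] and z = structure_hom(2)[OF gobj]
  note k1 = product_pair[OF prodn[of 0], simplified, OF p T_hom[OF gsrc], folded k1_def]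
  note k2 = product_pair[OF prodn[of 0], simplified, OF gunit z, folded k2_def]
  have k1n: "(\<T> ^^ n) q0 \<cdot> (\<T> ^^ n) k1 \<cdot> x = (\<T> ^^ n) (\<pp> (garr G)) \<cdot> x"
    "(\<T> ^^ n) q1 \<cdot> (\<T> ^^ n) k1 \<cdot> x = (\<T> ^^ n) (\<T> (gsrc G)) \<cdot> x"
    if "x \<in> hom C W ((\<T>\<^sub>o ^^ n) (\<T>\<^sub>o (garr G)))" for n x W
    using Tn_Cmp[OF k1(1) q(1), of n] Tn_Cmp[OF k1(1) q(2), of n] k1(2,3)
      Cmp_assoc[OF that Tn_hom[OF k1(1)] Tn_hom[OF q(1)]]
      Cmp_assoc[OF that Tn_hom[OF k1(1)] Tn_hom[OF q(2)]] by simp_all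
  have k2n: "(\<T> ^^ n) q0 \<cdot> (\<T> ^^ n) k2 \<cdot> y = (\<T> ^^ n) (gunit G) \<cdot> y"
    "(\<T> ^^ n) q1 \<cdot> (\<T> ^^ n) k2 \<cdot> y = (\<T> ^^ n) (\<zero> (gobj G)) \<cdot> y"
    if "y \<in> hom C W ((\<T>\<^sub>o ^^ n) (gobj G))" for n y W
    using Tn_Cmp[OF k2(1) q(1), of n] Tn_Cmp[OF k2(1) q(2), of n] k2(2,3)
      Cmp_assoc[OF that Tn_hom[OF k2(1)] Tn_hom[OF q(1)]]
      Cmp_assoc[OF that Tn_hom[OF k2(1)] Tn_hom[OF q(2)]] by simp_all
  have Dn: "Dom C ((\<T> ^^ n) k1) = (\<T>\<^sub>o ^^ n) (\<T>\<^sub>o (garr G))"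
    "Dom C ((\<T> ^^ n) k2) = (\<T>\<^sub>o ^^ n) (gobj G)" for n
    using Tn_hom[OF k1(1), of n] Tn_hom[OF k2(1), of n] by (simp_all add: hom_iff)
  note h = pullback_hom[OF pbn, unfolded Dn]
  show \<iota>: "\<iota> \<in> hom C A (\<T>\<^sub>o (garr G))" and \<pi>: "\<pi> \<in> hom C A (gobj G)"
    using h(1,2)[of 0] by simp_all
  have "k1 \<cdot> \<iota> = k2 \<cdot> \<pi>" using h(3)[of 0] by simp
  then show p\<iota>: "\<pp> (garr G) \<cdot> \<iota> = gunit G \<cdot> \<pi>" and "\<T> (gsrc G) \<cdot> \<iota> = \<zero> (gobj G) \<cdot> \<pi>"
    using k1n[of \<iota> A 0] k2n[of \<pi> A 0] \<iota> \<pi> by simp_all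
  show "\<exists>u. u \<in> hom C W ((\<T>\<^sub>o ^^ n) A) \<and> (\<T> ^^ n) \<iota> \<cdot> u = x \<and> (\<T> ^^ n) \<pi> \<cdot> u = y"
    if x: "x \<in> hom C W ((\<T>\<^sub>o ^^ n) (\<T>\<^sub>o (garr G)))" and y: "y \<in> hom C W ((\<T>\<^sub>o ^^ n) (gobj G))"
      and eqs: "(\<T> ^^ n) (\<pp> (garr G)) \<cdot> x = (\<T> ^^ n) (gunit G) \<cdot> y"
        "(\<T> ^^ n) (\<T> (gsrc G)) \<cdot> x = (\<T> ^^ n) (\<zero> (gobj G)) \<cdot> y" for n W x y
  proof -
    have "(\<T> ^^ n) k1 \<cdot> x = (\<T> ^^ n) k2 \<cdot> y"
      using product_eqI[OF prodn Cmp_hom[OF x Tn_hom[OF k1(1)]] Cmp_hom[OF y Tn_hom[OF k2(1)]]]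
        k1n[OF x] k2n[OF y] eqs by simp
    then show ?thesis
      using pullback_pair[OF pbn, unfolded Dn, OF x y] by blast
  qed
  show "u = u'"
    if u: "u \<in> hom C W ((\<T>\<^sub>o ^^ n) A)" and u': "u' \<in> hom C W ((\<T>\<^sub>o ^^ n) A)"
      and eq: "(\<T> ^^ n) \<iota> \<cdot> u = (\<T> ^^ n) \<iota> \<cdot> u'" for n W u u'
  proof -
    \<comment> \<open>\<open>\<pi> = t p \<iota>\<close>, so equality after \<open>\<iota>\<close> is equality in both components.\<close>
    have "gtgt G \<cdot> \<pp> (garr G) \<cdot> \<iota> = \<pi>"
      using cmp_left[OF tgt_unit, of \<pi>] \<pi> by (simp add: p\<iota> gcat hom_iff)
    moreover have "(\<T> ^^ n) (gtgt G \<cdot> \<pp> (garr G) \<cdot> \<iota>) =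
        ((\<T> ^^ n) (gtgt G) \<cdot> (\<T> ^^ n) (\<pp> (garr G))) \<cdot> (\<T> ^^ n) \<iota>"
      using Tn_Cmp[OF \<iota> p] Tn_Cmp[OF Cmp_hom[OF \<iota> p] gtgt]
        Cmp_assoc[OF Tn_hom[OF \<iota>] Tn_hom[OF p] Tn_hom[OF gtgt]] by simp
    ultimately have eq\<pi>: "(\<T> ^^ n) \<pi> = ((\<T> ^^ n) (gtgt G) \<cdot> (\<T> ^^ n) (\<pp> (garr G))) \<cdot> (\<T> ^^ n) \<iota>"
      by simp
    have "(\<T> ^^ n) \<pi> \<cdot> u = (\<T> ^^ n) \<pi> \<cdot> u'"
      unfolding eq\<pi> using eq Cmp_assoc[OF u Tn_hom[OF \<iota>] Cmp_hom[OF Tn_hom[OF p] Tn_hom[OF gtgt]]]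
        Cmp_assoc[OF u' Tn_hom[OF \<iota>] Cmp_hom[OF Tn_hom[OF p] Tn_hom[OF gtgt]]] by simp
    then show ?thesis using pullback_eqI[OF pbn u u' eq] by blast
  qed
qed

lemma iota_Ar:
  "\<iota> \<in> Ar C" "Dom C \<iota> = A" "Cod C \<iota> = \<T>\<^sub>o (garr G)"
  "\<pi> \<in> Ar C" "Dom C \<pi> = A" "Cod C \<pi> = gobj G" "A \<in> Ob C"
  using iota_hom pi_hom Dom_in_Ob[of \<iota>] by (simp_all add: hom_iff)

lemma factor_iota:
  assumes "u \<in> hom C W (\<T>\<^sub>o A)" "\<T> \<iota> \<cdot> u = f" "f \<in> hom C W Z"
  shows "factor C (\<T> \<iota>) f = u"
  using factor_eq[of u W "\<T> \<iota>" f Z] Tn_iota_mono[of _ W 1] assms by (simp add: iota_Ar gcat)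

lemma assoc_lift:
  shows assoc_lift_hom: "assoc_lift C G \<iota> \<in> hom C A (\<T>\<^sub>o A)"
    and T_iota_lift: "\<T> \<iota> \<cdot> assoc_lift C G \<iota> = \<ll> (garr G) \<cdot> \<iota>"
proof -
  have l\<iota>: "\<ll> (garr G) \<cdot> \<iota> \<in> hom C A (\<T>\<^sub>o (\<T>\<^sub>o (garr G)))"
    and y: "\<zero> (gobj G) \<cdot> \<pi> \<in> hom C A (\<T>\<^sub>o (gobj G))"
    by (simp_all add: hom_iff gcat iota_Ar)
  have "\<T> (\<pp> (garr G)) \<cdot> \<ll> (garr G) \<cdot> \<iota> = \<T> (gunit G) \<cdot> \<zero> (gobj G) \<cdot> \<pi>"
    using cmp_left[OF Tp_l[OF garr], of \<iota>] zero_nat'[OF gunit pi_hom]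
    by (simp add: gcat iota_Ar p_iota)
  moreover have "\<T> (\<T> (gsrc G)) \<cdot> \<ll> (garr G) \<cdot> \<iota> = \<T> (\<zero> (gobj G)) \<cdot> \<zero> (gobj G) \<cdot> \<pi>"
    using l_nat'[OF gsrc iota_hom] cmp_left[OF l_zero[OF gobj], of \<pi>]
    by (simp add: gcat iota_Ar Ts_iota)
  ultimately obtain u where u: "u \<in> hom C A (\<T>\<^sub>o A)" "\<T> \<iota> \<cdot> u = \<ll> (garr G) \<cdot> \<iota>"
    using into_TnA[of "\<ll> (garr G) \<cdot> \<iota>" A 1 "\<zero> (gobj G) \<cdot> \<pi>"] l\<iota> y by auto
  then have "assoc_lift C G \<iota> = u"
    using factor_iota[OF u l\<iota>] by (simp add: assoc_lift_def)
  with u show "assoc_lift C G \<iota> \<in> hom C A (\<T>\<^sub>o A)"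
    "\<T> \<iota> \<cdot> assoc_lift C G \<iota> = \<ll> (garr G) \<cdot> \<iota>" by simp_all
qed

lemma anchor_hom: "anchor C G \<iota> \<in> hom C A (\<T>\<^sub>o (gobj G))"
  by (simp add: anchor_def hom_iff gcat iota_Ar)

lemma prolong_pullback:
  "is_pullback C ((\<T> ^^ n) (anchor C G \<iota>)) ((\<T> ^^ n) (\<T> \<pi>)) ((\<T>\<^sub>o ^^ n) P) ((\<T> ^^ n) \<pi>\<^sub>0) ((\<T> ^^ n) \<pi>\<^sub>1)"
  using prolong unfolding prolongation_def T_pullback_def by blast

lemma prolong_Ar:
  "\<pi>\<^sub>0 \<in> Ar C" "Dom C \<pi>\<^sub>0 = P" "Cod C \<pi>\<^sub>0 = A" "\<pi>\<^sub>1 \<in> Ar C" "Dom C \<pi>\<^sub>1 = P" "Cod C \<pi>\<^sub>1 = \<T>\<^sub>o A"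
  and prolong_eq: "anchor C G \<iota> \<cdot> \<pi>\<^sub>0 = \<T> \<pi> \<cdot> \<pi>\<^sub>1"
  using pullback_hom[OF prolong_pullback[of 0]] anchor_hom
  by (simp_all add: hom_iff gcat iota_Ar)

lemma prolong_lift:
  shows prolong_lift_hom: "prolong_lift C G A \<iota> P \<pi>\<^sub>0 \<pi>\<^sub>1 \<in> hom C P (\<T>\<^sub>o P)"
    and T_pi0_lift: "\<T> \<pi>\<^sub>0 \<cdot> prolong_lift C G A \<iota> P \<pi>\<^sub>0 \<pi>\<^sub>1 = assoc_lift C G \<iota> \<cdot> \<pi>\<^sub>0"
    and T_pi1_lift: "\<T> \<pi>\<^sub>1 \<cdot> prolong_lift C G A \<iota> P \<pi>\<^sub>0 \<pi>\<^sub>1 = \<ll> A \<cdot> \<pi>\<^sub>1"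
proof -
  have L: "assoc_lift C G \<iota> \<in> Ar C" "Dom C (assoc_lift C G \<iota>) = A" "Cod C (assoc_lift C G \<iota>) = \<T>\<^sub>o A"
    and an: "anchor C G \<iota> \<in> Ar C" "Dom C (anchor C G \<iota>) = A" "Cod C (anchor C G \<iota>) = \<T>\<^sub>o (gobj G)"
    using assoc_lift_hom anchor_hom by (simp_all add: hom_iff)
  note s = gcat iota_Ar prolong_Ar L an
  have "\<T> (anchor C G \<iota>) \<cdot> assoc_lift C G \<iota> = \<ll> (gobj G) \<cdot> anchor C G \<iota>"
    using l_nat'[OF gtgt iota_hom] by (simp add: anchor_def s T_iota_lift)
  from cmp_left[OF this, of \<pi>\<^sub>0]
  have "\<T> (anchor C G \<iota>) \<cdot> assoc_lift C G \<iota> \<cdot> \<pi>\<^sub>0 = \<ll> (gobj G) \<cdot> \<T> \<pi> \<cdot> \<pi>\<^sub>1"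
    by (simp add: s prolong_eq)
  also have "\<dots> = \<T> (\<T> \<pi>) \<cdot> \<ll> A \<cdot> \<pi>\<^sub>1"
    using l_nat'[OF pi_hom, of \<pi>\<^sub>1 P] by (simp add: hom_iff s)
  finally have eq: "\<T> (anchor C G \<iota>) \<cdot> assoc_lift C G \<iota> \<cdot> \<pi>\<^sub>0 = \<T> (\<T> \<pi>) \<cdot> \<ll> A \<cdot> \<pi>\<^sub>1" .
  show "prolong_lift C G A \<iota> P \<pi>\<^sub>0 \<pi>\<^sub>1 \<in> hom C P (\<T>\<^sub>o P)"
    "\<T> \<pi>\<^sub>0 \<cdot> prolong_lift C G A \<iota> P \<pi>\<^sub>0 \<pi>\<^sub>1 = assoc_lift C G \<iota> \<cdot> \<pi>\<^sub>0"
    "\<T> \<pi>\<^sub>1 \<cdot> prolong_lift C G A \<iota> P \<pi>\<^sub>0 \<pi>\<^sub>1 = \<ll> A \<cdot> \<pi>\<^sub>1"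
    using pullback_pair[OF prolong_pullback[of 1], of "assoc_lift C G \<iota> \<cdot> \<pi>\<^sub>0" P "\<ll> A \<cdot> \<pi>\<^sub>1"] eq
    by (simp_all add: prolong_lift_def hom_iff s)
qed

section \<open>The map alpha\<close>

text \<open>The elements \<open>v\<close> of \<open>T(G)\<close> and \<open>w\<close> of \<open>T\<^sup>2(G)\<close> underlying the generic element of \<open>P\<close>.\<close>

definition elv :: 'a where "elv = \<iota> \<cdot> \<pi>\<^sub>0"
definition elw :: 'a where "elw = \<T> \<iota> \<cdot> \<pi>\<^sub>1"

lemma el_hom: "elv \<in> hom C P (\<T>\<^sub>o (garr G))" "elw \<in> hom C P (\<T>\<^sub>o (\<T>\<^sub>o (garr G)))"
  by (simp_all add: elv_def elw_def hom_iff gcat iota_Ar prolong_Ar)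

lemma el_Ar:
  "elv \<in> Ar C" "Dom C elv = P" "Cod C elv = \<T>\<^sub>o (garr G)"
  "elw \<in> Ar C" "Dom C elw = P" "Cod C elw = \<T>\<^sub>o (\<T>\<^sub>o (garr G))"
  using el_hom by (simp_all add: hom_iff)

lemmas pcat = gcat iota_Ar prolong_Ar el_Ar

lemma el_eqs:
  shows p_elv: "\<pp> (garr G) \<cdot> elv = gunit G \<cdot> \<pi> \<cdot> \<pi>\<^sub>0"
    and Ts_elv: "\<T> (gsrc G) \<cdot> elv = \<zero> (gobj G) \<cdot> \<pi> \<cdot> \<pi>\<^sub>0"
    and Tt_elv: "\<T> (gtgt G) \<cdot> elv = \<T> \<pi> \<cdot> \<pi>\<^sub>1"
    and TTs_elw: "\<T> (\<T> (gsrc G)) \<cdot> elw = \<T> (\<zero> (gobj G)) \<cdot> \<T> \<pi> \<cdot> \<pi>\<^sub>1"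
    and p_T_pi: "\<pp> (gobj G) \<cdot> \<T> \<pi> \<cdot> \<pi>\<^sub>1 = \<pi> \<cdot> \<pi>\<^sub>0"
proof -
  show pv: "\<pp> (garr G) \<cdot> elv = gunit G \<cdot> \<pi> \<cdot> \<pi>\<^sub>0"
    using cmp_left[OF p_iota, of \<pi>\<^sub>0] by (simp add: elv_def pcat)
  show "\<T> (gsrc G) \<cdot> elv = \<zero> (gobj G) \<cdot> \<pi> \<cdot> \<pi>\<^sub>0"
    using cmp_left[OF Ts_iota, of \<pi>\<^sub>0] by (simp add: elv_def pcat)
  show Ttv: "\<T> (gtgt G) \<cdot> elv = \<T> \<pi> \<cdot> \<pi>\<^sub>1"
    using prolong_eq by (simp add: elv_def anchor_def pcat)
  have "\<T> (\<T> (gsrc G)) \<cdot> \<T> \<iota> = \<T> (\<zero> (gobj G)) \<cdot> \<T> \<pi>"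
    using arg_cong[OF Ts_iota, of "\<T>"] by (simp add: pcat)
  from cmp_left[OF this, of \<pi>\<^sub>1]
  show "\<T> (\<T> (gsrc G)) \<cdot> elw = \<T> (\<zero> (gobj G)) \<cdot> \<T> \<pi> \<cdot> \<pi>\<^sub>1"
    by (simp add: elw_def pcat)
  show "\<pp> (gobj G) \<cdot> \<T> \<pi> \<cdot> \<pi>\<^sub>1 = \<pi> \<cdot> \<pi>\<^sub>0"
    using p_nat'[OF gtgt el_hom(1)] cmp_left[OF tgt_unit, of "\<pi> \<cdot> \<pi>\<^sub>0"] by (simp add: Ttv pv pcat)
qed

text \<open>The three factors of \<open>\<alpha>(v, w)\<close>; the last one, before inversion, is \<open>c0pw = T(0)pw\<close>.\<close>

definition fac_a :: 'a where "fac_a = \<cc> (garr G) \<cdot> elw"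
definition fac_b :: 'a where "fac_b = \<zero> (\<T>\<^sub>o (garr G)) \<cdot> elv"
definition fac_d :: 'a where "fac_d = \<T> (\<zero> (garr G)) \<cdot> \<pp> (\<T>\<^sub>o (garr G)) \<cdot> elw"

lemma fac_hom:
  "fac_a \<in> hom C P (\<T>\<^sub>o (\<T>\<^sub>o (garr G)))" "fac_b \<in> hom C P (\<T>\<^sub>o (\<T>\<^sub>o (garr G)))"
  "fac_d \<in> hom C P (\<T>\<^sub>o (\<T>\<^sub>o (garr G)))"
  by (simp_all add: fac_a_def fac_b_def fac_d_def hom_iff pcat)

lemma src_tgt_p_elw:
  "\<T> (gsrc G) \<cdot> \<pp> (\<T>\<^sub>o (garr G)) \<cdot> elw = \<zero> (gobj G) \<cdot> \<pi> \<cdot> \<pi>\<^sub>0"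
  "\<T> (gtgt G) \<cdot> \<pp> (\<T>\<^sub>o (garr G)) \<cdot> elw = anchor C G \<iota> \<cdot> \<pp> A \<cdot> \<pi>\<^sub>1"
proof -
  have y: "\<T> \<pi> \<cdot> \<pi>\<^sub>1 \<in> hom C P (\<T>\<^sub>o (gobj G))" by (simp add: hom_iff pcat)
  have "\<T> (gsrc G) \<cdot> \<pp> (\<T>\<^sub>o (garr G)) \<cdot> elw = \<pp> (\<T>\<^sub>o (gobj G)) \<cdot> \<T> (\<zero> (gobj G)) \<cdot> \<T> \<pi> \<cdot> \<pi>\<^sub>1"
    using p_nat'[OF T_hom[OF gsrc] el_hom(2)] by (simp add: TTs_elw)
  also have "\<dots> = \<zero> (gobj G) \<cdot> \<pi> \<cdot> \<pi>\<^sub>0"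
    using p_nat'[OF structure_hom(2)[OF gobj] y] by (simp add: p_T_pi)
  finally show "\<T> (gsrc G) \<cdot> \<pp> (\<T>\<^sub>o (garr G)) \<cdot> elw = \<zero> (gobj G) \<cdot> \<pi> \<cdot> \<pi>\<^sub>0" .
  have "\<pp> (\<T>\<^sub>o (garr G)) \<cdot> elw = \<iota> \<cdot> \<pp> A \<cdot> \<pi>\<^sub>1"
    using p_nat'[OF iota_hom, of \<pi>\<^sub>1 P] by (simp add: elw_def hom_iff pcat)
  then show "\<T> (gtgt G) \<cdot> \<pp> (\<T>\<^sub>o (garr G)) \<cdot> elw = anchor C G \<iota> \<cdot> \<pp> A \<cdot> \<pi>\<^sub>1"
    by (simp add: anchor_def pcat)
qed

text \<open>Used with \<open>f = s\<close> and \<open>f = t\<close>: source and target of \<open>c0pw\<close> in terms of those of \<open>pw\<close>.\<close>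

lemma TT_fac_d:
  assumes f: "f \<in> hom C (garr G) (gobj G)"
  shows "\<T> (\<T> f) \<cdot> fac_d = \<T> (\<zero> (gobj G)) \<cdot> \<T> f \<cdot> \<pp> (\<T>\<^sub>o (garr G)) \<cdot> elw"
proof -
  have f': "f \<in> Ar C" "Dom C f = garr G" "Cod C f = gobj G" using f by (simp_all add: hom_iff)
  have "\<T> (\<T> f) \<cdot> \<T> (\<zero> (garr G)) = \<T> (\<zero> (gobj G)) \<cdot> \<T> f"
    using arg_cong[OF zero_nat[OF f], of "\<T>"] by (simp add: pcat f')
  from cmp_left[OF this, of "\<pp> (\<T>\<^sub>o (garr G)) \<cdot> elw"] show ?thesis
    by (simp add: fac_d_def pcat f')
qed

lemma conjugable_fac: "conjugable 2 P fac_a fac_b fac_d"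
proof -
  have y: "\<T> \<pi> \<cdot> \<pi>\<^sub>1 \<in> hom C P (\<T>\<^sub>o (gobj G))" by (simp add: hom_iff pcat)
  have x: "\<pi> \<cdot> \<pi>\<^sub>0 \<in> hom C P (gobj G)" by (simp add: hom_iff pcat)
  have "\<T> (\<T> (gsrc G)) \<cdot> fac_a = \<zero> (\<T>\<^sub>o (gobj G)) \<cdot> \<T> \<pi> \<cdot> \<pi>\<^sub>1"
    using c_nat'[OF gsrc el_hom(2)] cmp_left[OF c_Tzero[OF gobj], of "\<T> \<pi> \<cdot> \<pi>\<^sub>1"]
    by (simp add: fac_a_def TTs_elw pcat)
  moreover have "\<T> (\<T> (gtgt G)) \<cdot> fac_b = \<zero> (\<T>\<^sub>o (gobj G)) \<cdot> \<T> \<pi> \<cdot> \<pi>\<^sub>1"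
    using zero_nat'[OF T_hom[OF gtgt] el_hom(1)] by (simp add: fac_b_def Tt_elv)
  moreover have "\<T> (\<T> (gsrc G)) \<cdot> fac_b = \<T> (\<T> (gsrc G)) \<cdot> fac_d"
    using zero_nat'[OF T_hom[OF gsrc] el_hom(1)] zero_nat'[OF structure_hom(2)[OF gobj] x]
    by (simp add: TT_fac_d[OF gsrc] src_tgt_p_elw Ts_elv fac_b_def)
  ultimately show ?thesis
    using fac_hom by (simp add: conjugable_def composable_def numeral_2_eq_2)
qed

lemma natural_Tp: "natural C (\<T>\<^sub>o ^^ 2) (\<T> ^^ 2) (\<T>\<^sub>o ^^ 1) (\<T> ^^ 1) (\<lambda>X. \<T> (\<pp> X))"
proof -
  have "\<T> f \<cdot> \<T> (\<pp> X) = \<T> (\<pp> Y) \<cdot> \<T> (\<T> f)" if "f \<in> hom C X Y" for f X Y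
    using arg_cong[OF p_nat[OF that], of "\<T>"] that Dom_in_Ob[of f] Cod_in_Ob[of f]
    by (simp add: hom_iff tcat)
  then show ?thesis
    using T_hom[OF structure_hom(1)] by (simp add: natural_def numeral_2_eq_2)
qed

lemma natural_c_Tl:
  "natural C (\<T>\<^sub>o ^^ 2) (\<T> ^^ 2) (\<T>\<^sub>o ^^ 3) (\<T> ^^ 3) (\<lambda>X. \<cc> (\<T>\<^sub>o X) \<cdot> \<T> (\<ll> X))"
proof -
  have "\<T> (\<T> (\<T> f)) \<cdot> \<cc> (\<T>\<^sub>o X) \<cdot> \<T> (\<ll> X) = (\<cc> (\<T>\<^sub>o Y) \<cdot> \<T> (\<ll> Y)) \<cdot> \<T> (\<T> f)"
    if f: "f \<in> hom C X Y" for f X Y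
  proof -
    have f': "f \<in> Ar C" "Dom C f = X" "Cod C f = Y" "X \<in> Ob C" "Y \<in> Ob C"
      using f Dom_in_Ob[of f] Cod_in_Ob[of f] by (auto simp: hom_iff)
    have "\<T> (\<ll> Y) \<cdot> \<T> (\<T> f) = \<T> (\<T> (\<T> f)) \<cdot> \<T> (\<ll> X)"
      using arg_cong[OF l_nat[OF f], of "\<T>"] by (simp add: tcat f')
    then show ?thesis
      using c_nat'[OF T_hom[OF f], of "\<T> (\<ll> X)"] by (simp add: hom_iff tcat f')
  qed
  then show ?thesis
    using Cmp_hom[OF T_hom[OF structure_hom(3)] structure_hom(4)[OF T_Ob]]
    by (simp add: natural_def numeral_2_eq_2 numeral_3_eq_3)
qed

lemma alpha:
  shows alpha_hom: "alpha C G \<iota> \<pi>\<^sub>0 \<pi>\<^sub>1 \<in> hom C P (\<T>\<^sub>o A)"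
    and T_iota_alpha: "\<T> \<iota> \<cdot> alpha C G \<iota> \<pi>\<^sub>0 \<pi>\<^sub>1 = gconj 2 fac_a fac_b fac_d"
    and T_pi_alpha: "\<T> \<pi> \<cdot> alpha C G \<iota> \<pi>\<^sub>0 \<pi>\<^sub>1 = anchor C G \<iota> \<cdot> \<pp> A \<cdot> \<pi>\<^sub>1"
proof -
  let ?y = "anchor C G \<iota> \<cdot> \<pp> A \<cdot> \<pi>\<^sub>1" and ?a = "gconj 2 fac_a fac_b fac_d"
    and ?pw = "\<pp> (\<T>\<^sub>o (garr G)) \<cdot> elw"
  have pw: "?pw \<in> hom C P (\<T>\<^sub>o (garr G))" by (simp add: hom_iff pcat)
  have x: "\<pi> \<cdot> \<pi>\<^sub>0 \<in> hom C P (gobj G)" by (simp add: hom_iff pcat)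
  have ah: "?a \<in> hom C P (\<T>\<^sub>o (\<T>\<^sub>o (garr G)))"
    using gconj_hom[OF conjugable_fac] by (simp add: numeral_2_eq_2)
  have yh: "?y \<in> hom C P (\<T>\<^sub>o (gobj G))" by (simp add: anchor_def hom_iff pcat)
  \<comment> \<open>\<open>T(p)\<close> sends the outer factors to \<open>pw\<close> and the middle one to the unit at the source of \<open>pw\<close>.\<close>
  have a: "\<T> (\<pp> (garr G)) \<cdot> fac_a = ?pw"
    using cmp_left[OF Tp_c[OF garr], of elw] by (simp add: fac_a_def pcat)
  have b: "\<T> (\<pp> (garr G)) \<cdot> fac_b = \<T> (gunit G) \<cdot> \<T> (gsrc G) \<cdot> ?pw"
    using zero_nat'[OF structure_hom(1)[OF garr] el_hom(1)] zero_nat'[OF gunit x]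
    by (simp add: fac_b_def p_elv src_tgt_p_elw)
  have "\<T> (\<pp> (garr G)) \<cdot> \<T> (\<zero> (garr G)) = Id C (\<T>\<^sub>o (garr G))"
    using arg_cong[OF p_zero[OF garr], of "\<T>"] by (simp add: pcat)
  from cmp_left[OF this, of ?pw] have d: "\<T> (\<pp> (garr G)) \<cdot> fac_d = ?pw"
    by (simp add: fac_d_def pcat)
  have "\<T> (\<pp> (garr G)) \<cdot> ?a = gconj 1 ?pw (\<T> (gunit G) \<cdot> \<T> (gsrc G) \<cdot> ?pw) ?pw"
    using gconj_natural[OF natural_Tp conjugable_fac] by (simp add: a b d)
  also have "\<dots> = \<T> (gunit G) \<cdot> ?y"
    using gconj_unit[of ?pw P 1] pw by (simp add: src_tgt_p_elw)
  finally have 1: "\<T> (\<pp> (garr G)) \<cdot> ?a = \<T> (gunit G) \<cdot> ?y" .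
  have 2: "\<T> (\<T> (gsrc G)) \<cdot> ?a = \<T> (\<zero> (gobj G)) \<cdot> ?y"
    using gconj_src[OF conjugable_fac] TT_fac_d[OF gtgt] by (simp add: numeral_2_eq_2 src_tgt_p_elw)
  obtain u where u: "u \<in> hom C P (\<T>\<^sub>o A)" "\<T> \<iota> \<cdot> u = ?a" "\<T> \<pi> \<cdot> u = ?y"
    using into_TnA[of ?a P 1 ?y] ah yh 1 2 by auto
  have "\<cc> (garr G) \<cdot> \<zero> (\<T>\<^sub>o (garr G)) \<cdot> ?pw = fac_d"
    using cmp_left[OF c_zero[OF garr], of ?pw] by (simp add: fac_d_def pcat)
  then have "alpha C G \<iota> \<pi>\<^sub>0 \<pi>\<^sub>1 = factor C (\<T> \<iota>) ?a"
    by (simp add: alpha_def Let_def gconj_def fac_a_def fac_b_def elw_def elv_def)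
  also have "\<dots> = u" by (rule factor_iota[OF u(1,2) ah])
  finally show "alpha C G \<iota> \<pi>\<^sub>0 \<pi>\<^sub>1 \<in> hom C P (\<T>\<^sub>o A)"
    and "\<T> \<iota> \<cdot> alpha C G \<iota> \<pi>\<^sub>0 \<pi>\<^sub>1 = ?a" and "\<T> \<pi> \<cdot> alpha C G \<iota> \<pi>\<^sub>0 \<pi>\<^sub>1 = ?y"
    using u by simp_all
qed

text \<open>Both sides are elements of \<open>T\<^sup>2(A)\<close>, and in \<open>T\<^sup>3(G)\<close> both become
  \<open>T(c)lw \<circ> T(0)lv \<circ> (T(T(0))0pw)\<^sup>-\<^sup>1\<close>: the left one because \<open>T\<close> acts on composites, the right
  one because \<open>cT(l)\<close> is a homomorphism.\<close>

lemma alpha_linear: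
  "\<T> (alpha C G \<iota> \<pi>\<^sub>0 \<pi>\<^sub>1) \<cdot> prolong_lift C G A \<iota> P \<pi>\<^sub>0 \<pi>\<^sub>1 =
    (\<cc> A \<cdot> \<T> (assoc_lift C G \<iota>)) \<cdot> alpha C G \<iota> \<pi>\<^sub>0 \<pi>\<^sub>1"
proof -
  let ?al = "alpha C G \<iota> \<pi>\<^sub>0 \<pi>\<^sub>1" and ?L = "prolong_lift C G A \<iota> P \<pi>\<^sub>0 \<pi>\<^sub>1"
    and ?lam = "assoc_lift C G \<iota>" and ?G = "garr G"
  let ?a = "gconj 2 fac_a fac_b fac_d"
  have Ar: "?al \<in> Ar C" "Dom C ?al = P" "Cod C ?al = \<T>\<^sub>o A"
    "?L \<in> Ar C" "Dom C ?L = P" "Cod C ?L = \<T>\<^sub>o P"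
    "?lam \<in> Ar C" "Dom C ?lam = A" "Cod C ?lam = \<T>\<^sub>o A"
    using alpha_hom prolong_lift_hom assoc_lift_hom by (simp_all add: hom_iff)
  have fac: "fac_a \<in> Ar C" "Dom C fac_a = P" "Cod C fac_a = \<T>\<^sub>o (\<T>\<^sub>o ?G)"
    "fac_b \<in> Ar C" "Dom C fac_b = P" "Cod C fac_b = \<T>\<^sub>o (\<T>\<^sub>o ?G)"
    "fac_d \<in> Ar C" "Dom C fac_d = P" "Cod C fac_d = \<T>\<^sub>o (\<T>\<^sub>o ?G)"
    using fac_hom by (simp_all add: hom_iff)
  note s = pcat Ar fac
  let ?A3 = "\<T> (\<cc> ?G) \<cdot> \<ll> (\<T>\<^sub>o ?G) \<cdot> elw" and ?B3 = "\<T> (\<zero> (\<T>\<^sub>o ?G)) \<cdot> \<ll> ?G \<cdot> elv"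
    and ?D3 = "\<T> (\<T> (\<zero> ?G)) \<cdot> \<zero> (\<T>\<^sub>o ?G) \<cdot> \<pp> (\<T>\<^sub>o ?G) \<cdot> elw"
  have Tw: "\<T> elw \<cdot> ?L = \<ll> (\<T>\<^sub>o ?G) \<cdot> elw"
    using l_nat'[OF iota_hom, of \<pi>\<^sub>1 P] by (simp add: elw_def s T_pi1_lift hom_iff)
  have Tv: "\<T> elv \<cdot> ?L = \<ll> ?G \<cdot> elv"
    using cmp_left[OF T_iota_lift, of \<pi>\<^sub>0] by (simp add: elv_def s T_pi0_lift)
  have left: "\<T> fac_a \<cdot> ?L = ?A3" "\<T> fac_b \<cdot> ?L = ?B3"
    by (simp_all add: fac_a_def fac_b_def s Tw Tv)
  have left': "\<T> fac_d \<cdot> ?L = ?D3"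
    using cmp_left[OF Tp_l[of "\<T>\<^sub>o ?G"], of elw] by (simp add: fac_d_def s Tw)
  have "\<T> (\<T> \<iota>) \<cdot> \<T> ?al \<cdot> ?L = \<T> ?a \<cdot> ?L"
    using cmp_left[of "\<T> (\<T> \<iota>)" "\<T> ?al" "\<T> ?a" ?L] arg_cong[OF T_iota_alpha, of "\<T>"]
    by (simp add: s)
  also have "\<dots> = gconj 3 ?A3 ?B3 ?D3"
    using gconj_T[OF conjugable_fac prolong_lift_hom] by (simp add: left left')
  finally have lhs: "\<T> (\<T> \<iota>) \<cdot> \<T> ?al \<cdot> ?L = gconj 3 ?A3 ?B3 ?D3" .
  let ?\<eta> = "\<cc> (\<T>\<^sub>o ?G) \<cdot> \<T> (\<ll> ?G)"
  have ra: "?\<eta> \<cdot> fac_a = ?A3"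
    using cmp_left[OF c_Tl_c[OF garr], of elw] by (simp add: fac_a_def s)
  have "\<T> (\<ll> ?G) \<cdot> fac_b = \<zero> (\<T>\<^sub>o (\<T>\<^sub>o ?G)) \<cdot> \<ll> ?G \<cdot> elv"
    using zero_nat'[OF structure_hom(3)[OF garr] el_hom(1)] by (simp add: fac_b_def)
  then have rb: "?\<eta> \<cdot> fac_b = ?B3"
    using cmp_left[OF c_zero[of "\<T>\<^sub>o ?G"], of "\<ll> ?G \<cdot> elv"] by (simp add: s)
  have "\<T> (\<ll> ?G) \<cdot> \<T> (\<zero> ?G) = \<T> (\<T> (\<zero> ?G)) \<cdot> \<T> (\<zero> ?G)"
    using arg_cong[OF l_zero[OF garr], of "\<T>"] by (simp add: s)
  from cmp_left[OF this, of "\<pp> (\<T>\<^sub>o ?G) \<cdot> elw"]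
  have "\<T> (\<ll> ?G) \<cdot> fac_d = \<T> (\<T> (\<zero> ?G)) \<cdot> fac_d" by (simp add: fac_d_def s)
  then have rd: "?\<eta> \<cdot> fac_d = ?D3"
    using c_nat'[OF structure_hom(2)[OF garr] fac_hom(3)]
      cmp_left[OF c_Tzero[OF garr], of "\<pp> (\<T>\<^sub>o ?G) \<cdot> elw"]
    by (simp add: s) (simp add: fac_d_def s)
  have "\<T> (\<T> \<iota>) \<cdot> \<T> ?lam = \<T> (\<ll> ?G) \<cdot> \<T> \<iota>"
    using arg_cong[OF T_iota_lift, of "\<T>"] by (simp add: s)
  from cmp_left[OF this, of ?al]
  have lam: "\<T> (\<T> \<iota>) \<cdot> \<T> ?lam \<cdot> ?al = \<T> (\<ll> ?G) \<cdot> ?a"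
    by (simp add: s T_iota_alpha)
  have "\<T> (\<T> \<iota>) \<cdot> \<cc> A \<cdot> \<T> ?lam \<cdot> ?al = \<cc> (\<T>\<^sub>o ?G) \<cdot> \<T> (\<ll> ?G) \<cdot> ?a"
    using c_nat'[OF iota_hom, of "\<T> ?lam \<cdot> ?al" P] by (simp add: s lam hom_iff)
  also have "\<dots> = ?\<eta> \<cdot> ?a"
    using gconj_hom[OF conjugable_fac] by (simp add: s hom_iff numeral_2_eq_2)
  also have "\<dots> = gconj 3 ?A3 ?B3 ?D3"
    using gconj_natural[OF natural_c_Tl conjugable_fac] by (simp only: ra rb rd)
  finally have "\<T> (\<T> \<iota>) \<cdot> \<cc> A \<cdot> \<T> ?lam \<cdot> ?al = gconj 3 ?A3 ?B3 ?D3" .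
  with lhs have "\<T> ?al \<cdot> ?L = \<cc> A \<cdot> \<T> ?lam \<cdot> ?al"
    using Tn_iota_mono[of "\<T> ?al \<cdot> ?L" P 2 "\<cc> A \<cdot> \<T> ?lam \<cdot> ?al"]
    by (simp add: s hom_iff numeral_2_eq_2)
  then show ?thesis by (simp add: s)
qed

end

theorem lemma3p3p0p7:
  fixes C :: "('o, 'a, 'm) tangent_data_scheme" (structure)
    and G :: "('o, 'a) groupoid_data"
  assumes "groupoid C G"
    and "associated_bundle C G A \<pi> \<iota>"
    and "prolongation C G \<pi> \<iota> P \<pi>\<^sub>0 \<pi>\<^sub>1"
  shows "linear_bundle_morphism C
    P A (\<pp> A \<cdot> \<pi>\<^sub>1) (prolong_lift C G A \<iota> P \<pi>\<^sub>0 \<pi>\<^sub>1)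
    (\<T>\<^sub>o A) (\<T>\<^sub>o (gobj G)) (\<T> \<pi>) (\<cc> A \<cdot> \<T> (assoc_lift C G \<iota>))
    (anchor C G \<iota>) (alpha C G \<iota> \<pi>\<^sub>0 \<pi>\<^sub>1)"
proof -
  interpret groupoid_prolongation C G A \<pi> \<iota> P \<pi>\<^sub>0 \<pi>\<^sub>1
    using assms by (simp add: groupoid_prolongation_def groupoid_prolongation_axioms_def)
  have "\<pp> A \<cdot> \<pi>\<^sub>1 \<in> hom C P A" and "\<T> \<pi> \<in> hom C (\<T>\<^sub>o A) (\<T>\<^sub>o (gobj G))"
    by (simp_all add: hom_iff pcat)
  moreover have "\<cc> A \<cdot> \<T> (assoc_lift C G \<iota>) \<in> hom C (\<T>\<^sub>o A) (\<T>\<^sub>o (\<T>\<^sub>o A))"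
    using Cmp_hom[OF T_hom[OF assoc_lift_hom] structure_hom(4)] by (simp add: pcat)
  ultimately show ?thesis
    unfolding linear_bundle_morphism_def bundle_with_lift_def
    using prolong_lift_hom anchor_hom alpha_hom T_pi_alpha alpha_linear by blast
qed

end
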